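(* Let $\alpha>0$ and let $\{Z_i\}_{i\in\mathbb{Z}}$ be i.i.d. positive random variables with finite mean. For any $\gamma\in(0,1)$ there exists a positive constant $C$ such that $$\frac{1}{CL}\,e^{-\zeta_L^\alpha}\;\le\;\Phi_L(\xi)\;\le\;\frac{C(\log L)^2}{L}\,e^{-d(\alpha)\,\zeta_{\gamma L}^\alpha},\qquad\mathbb{P}\text{-a.s.},$$ where $d(\alpha):=1\wedge3^{\alpha-1}$. If there exists $\varepsilon>0$ such that $\mathbb{P}(Z_i>\varepsilon)=1$, then the same holds without the $(\log L)^2$ factor in the right-hand side.
   Context: $\xi=\{x_k\}_{k\in\mathbb{Z}}$ is the renewal point process with $x_0=0$, $x_k=x_{k-1}+Z_{k-1}$; $\mathbb{P}$ is its law. For $L>0$: $\Lambda_L=[-L/2,L/2]$, $\xi_L=\xi\cap\Lambda_L$, and $\#(U)$ is the number of points of $U$. Cheeger's isoperimetric constant is $$\Phi_L(\xi)=\min_{\emptyset\ne U\subset\xi_L:\ \#(U)\le\frac12\#(\xi_L)}I_U(\xi),\qquad I_U(\xi)=\frac1{\#(U)}\sum_{x\in U,\ y\in\xi_L\setminus U}e^{-|x-y|^\alpha}.$$ The maximal distance between consecutive points is $\zeta_L=\max\{x_{k+1}-x_k:\ x_k,x_{k+1}\in\xi_L\}$. Convention: an assertion depending on $L$ holds "$\mathbb{P}$-a.s." if with $\mathbb{P}$-probability $1$ there is $L_0=L_0(\xi)<\infty$ such that it holds for all $L\in\mathbb{N}$ with $L\ge L_0$. Constants such as $C$ are deterministic.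 *)

theory Defs
  imports "HOL-Probability.Probability"
begin

text \<open>
  The functions below act on one realisation: \<open>z\<close> is a realisation of the spacings \<open>Z\<close>,
  \<open>x\<close> the induced sequence of points, and \<open>\<xi> = range x\<close> the point configuration.
\<close>

text \<open>
  The solution of \<open>x 0 = 0\<close> and \<open>x k = x (k - 1) + z (k - 1)\<close> for all integers \<open>k\<close>;
  see \<open>renewal_seq_0\<close>, \<open>renewal_seq_step\<close> and \<open>renewal_seq_unique\<close>.
\<close>
definition renewal_seq :: "(int \<Rightarrow> real) \<Rightarrow> int \<Rightarrow> real" where
  "renewal_seq z k = (if 0 \<le> k then \<Sum>i\<in>{0..<k}. z i else - (\<Sum>i\<in>{k..<0}. z i))"

definition window :: "real \<Rightarrow> real set" where
  "window L = {- (L / 2)..L / 2}"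

definition iso_ratio :: "real \<Rightarrow> real set \<Rightarrow> real \<Rightarrow> real set \<Rightarrow> real" where
  "iso_ratio \<alpha> \<xi> L U =
     (1 / real (card U)) * (\<Sum>x\<in>U. \<Sum>y\<in>(\<xi> \<inter> window L) - U. exp (- (\<bar>x - y\<bar> powr \<alpha>)))"

text \<open>
  \<open>Min\<close> is meaningful when \<open>\<xi> \<inter> window L\<close> is finite with at least two points, and
  \<open>max_gap\<close> when its set is finite and nonempty. Almost surely both are the case for all
  large \<open>L\<close>; otherwise the values are unspecified.
\<close>
definition cheeger :: "real \<Rightarrow> real set \<Rightarrow> real \<Rightarrow> real" where
  "cheeger \<alpha> \<xi> L =
     Min (iso_ratio \<alpha> \<xi> L `
       {U. U \<noteq> {} \<and> U \<subseteq> \<xi> \<inter> window L \<and> real (card U) \<le> (1 / 2) * real (card (\<xi> \<inter> window L))})"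

definition max_gap :: "(int \<Rightarrow> real) \<Rightarrow> real \<Rightarrow> real" where
  "max_gap x L =
     Max {x (k + 1) - x k | k. x k \<in> range x \<inter> window L \<and> x (k + 1) \<in> range x \<inter> window L}"

definition d_exp :: "real \<Rightarrow> real" where
  "d_exp \<alpha> = min 1 (3 powr (\<alpha> - 1))"

lemma renewal_seq_0: "renewal_seq z 0 = 0"
  by (simp add: renewal_seq_def)

lemma renewal_seq_step: "renewal_seq z k = renewal_seq z (k - 1) + z (k - 1)"
proof (cases "1 \<le> k")
  case True
  then have "{0..<k} = insert (k - 1) {0..<k - 1}" by auto
  with True show ?thesis by (simp add: renewal_seq_def)
next
  case False
  then have "{k - 1..<0} = insert (k - 1) {k..<0}" by auto
  with False show ?thesis by (cases "k = 0") (simp_all add: renewal_seq_def)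
qed

lemma renewal_seq_unique:
  assumes "x 0 = 0" and step: "\<And>k. x k = x (k - 1) + z (k - 1)"
  shows "x = renewal_seq z"
proof
  fix k :: int
  show "x k = renewal_seq z k"
  proof (induction k rule: int_induct[where k = 0])
    case base
    then show ?case using assms(1) by (simp add: renewal_seq_0)
  next
    case (step1 i)
    then show ?case using step[of "i + 1"] renewal_seq_step[of z "i + 1"] by simp
  next
    case (step2 i)
    then show ?case using step[of i] renewal_seq_step[of z i] by simp
  qed
qed

end

theory Submission
  imports Defs "HOL-Real_Asymp.Real_Asymp"
begin

text \<open>
  A set \<open>U\<close> of points that is neither empty nor all of the window separates two consecutive points,
  so its boundary sum contains a term that is at least \<open>exp (- max_gap powr \<alpha>)\<close>; since the window of
  length \<open>L\<close> holds \<open>O(L)\<close> points, the lower bound follows (\<open>cheeger_ge\<close>).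

  For the upper bound, cut the configuration at the largest gap \<open>g\<close> of the inner window of length
  \<open>\<gamma> L\<close> and take for \<open>U\<close> the side with fewer points. Both sides contain one of the two margins between
  the inner and the outer window, hence order \<open>L\<close> points. A pair of points across the cut is at distance
  \<open>g + s + t\<close>, where \<open>s\<close> and \<open>t\<close> are the distances to the ends of the gap, and
  \<open>(g + s + t) powr \<alpha> \<ge> d_exp \<alpha> * (g powr \<alpha> + s powr \<alpha> + t powr \<alpha>)\<close>
  (\<open>d_exp_superadditive\<close>); this inequality is where the constant \<open>d_exp \<alpha>\<close> comes from. The boundary sum
  therefore factorises into \<open>exp (- d_exp \<alpha> * g powr \<alpha>)\<close> and one sum over each side. If every \<open>m\<close>
  consecutive spacings have total length at least \<open>\<epsilon>\<close>, each of these two sums is at most \<open>m\<close> times a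
  convergent series (\<open>sum_exp_neg_powr_le\<close>), whence a factor \<open>m\<^sup>2\<close> (\<open>cut_energy_le\<close>).

  Two almost sure properties of the spacings feed this deterministic argument (\<open>cheeger_bounds\<close>). The
  strong law of large numbers, applied to the right and to the left of the origin, yields the point
  counts. A Chernoff bound with the Borel-Cantelli lemma shows that blocks of \<open>m = O(ln L)\<close> spacings have
  length at least \<open>1\<close> throughout the window (\<open>logarithmic_blocks_are_long\<close>), which accounts for
  \<open>(ln L)\<^sup>2\<close>; if all spacings exceed \<open>\<epsilon>\<close>, then \<open>m = 1\<close> will do.

  The strong law is proved under a first moment assumption by an argument from ergodic theory: a random
  walk with negative drift is almost surely bounded above
  (\<open>partial_sums_bounded_of_negative_drift\<close>), and this is applied to the summands shifted by a constant
  slightly larger than their mean, and to their negatives.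
\<close>

section \<open>The stretched exponential\<close>

lemma d_exp_pos: "0 < d_exp \<alpha>"
  by (simp add: d_exp_def)

text \<open>
  Bernoulli's inequality for a concave power, from the convexity of the exponential.
\<close>
lemma powr_le_tangent_at_1:
  fixes v :: real
  assumes "0 < \<alpha>" "\<alpha> \<le> 1" "0 \<le> v"
  shows "v powr \<alpha> \<le> 1 + \<alpha> * (v - 1)"
proof (cases "v = 0")
  case True
  then show ?thesis using assms by simp
next
  case False
  then have v: "0 < v" using assms by simp
  have "exp ((1 - \<alpha>) *\<^sub>R 0 + \<alpha> *\<^sub>R ln v) \<le> (1 - \<alpha>) * exp 0 + \<alpha> * exp (ln v)"
    using assms by (intro convex_onD[OF exp_convex]) auto
  then show ?thesis using v by (simp add: powr_def algebra_simps)
qed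

text \<open>
  By homogeneity the three arguments may be taken to sum to \<open>1\<close>. For \<open>\<alpha> \<ge> 1\<close> each power is then at most
  its base. For \<open>\<alpha> < 1\<close> the sum of the powers is largest when all three are \<open>1/3\<close>, where it equals
  \<open>3 powr (1 - \<alpha>)\<close>: bound every summand by the tangent at that point.
\<close>
lemma d_exp_superadditive:
  fixes a b c :: real
  assumes \<alpha>: "0 < \<alpha>" and nonneg: "0 \<le> a" "0 \<le> b" "0 \<le> c"
  shows "d_exp \<alpha> * (a powr \<alpha> + b powr \<alpha> + c powr \<alpha>) \<le> (a + b + c) powr \<alpha>"
proof (cases "a + b + c = 0")
  case True
  with nonneg have "a = 0" "b = 0" "c = 0" by auto
  then show ?thesis by simp
next
  case False
  define s where "s = a + b + c"
  have s: "0 < s" using False nonneg by (simp add: s_def)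
  have sum1: "a / s + b / s + c / s = 1" using s by (simp add: s_def add_divide_distrib[symmetric])
  have u: "0 \<le> a / s" "0 \<le> b / s" "0 \<le> c / s" using s nonneg by auto
  have u1: "a / s \<le> 1" "b / s \<le> 1" "c / s \<le> 1" using sum1 u by linarith+
  have key: "d_exp \<alpha> * ((a / s) powr \<alpha> + (b / s) powr \<alpha> + (c / s) powr \<alpha>) \<le> 1"
  proof (cases "1 \<le> \<alpha>")
    case True
    have le: "t powr \<alpha> \<le> t" if "0 \<le> t" "t \<le> 1" for t :: real
      using powr_mono'[of 1 \<alpha> t] that True by simp
    have "(a / s) powr \<alpha> + (b / s) powr \<alpha> + (c / s) powr \<alpha> \<le> 1"
      using le[OF u(1) u1(1)] le[OF u(2) u1(2)] le[OF u(3) u1(3)] sum1 by linarith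
    moreover have "d_exp \<alpha> = 1" using True by (simp add: d_exp_def min_def ge_one_powr_ge_zero)
    ultimately show ?thesis by simp
  next
    case False
    have le: "3 powr \<alpha> * t powr \<alpha> \<le> 1 + \<alpha> * (3 * t - 1)" if "0 \<le> t" for t :: real
      using powr_le_tangent_at_1[of \<alpha> "3 * t"] that False \<alpha> by (simp add: powr_mult)
    have "3 powr \<alpha> * ((a / s) powr \<alpha> + (b / s) powr \<alpha> + (c / s) powr \<alpha>)
        \<le> 3 + \<alpha> * (3 * (a / s + b / s + c / s) - 3)"
      using le[OF u(1)] le[OF u(2)] le[OF u(3)] by (simp only: distrib_left right_diff_distrib)
    then have "3 powr \<alpha> * ((a / s) powr \<alpha> + (b / s) powr \<alpha> + (c / s) powr \<alpha>) \<le> 3"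
      unfolding sum1 by simp
    moreover have "d_exp \<alpha> \<le> 3 powr \<alpha> / 3" by (simp add: d_exp_def powr_diff)
    moreover have "0 \<le> (a / s) powr \<alpha> + (b / s) powr \<alpha> + (c / s) powr \<alpha>" by simp
    ultimately show ?thesis
      by (smt (verit) mult_right_mono divide_le_eq_1 times_divide_eq_left)
  qed
  have scale: "t powr \<alpha> = s powr \<alpha> * (t / s) powr \<alpha>" if "0 \<le> t" for t
    using s that by (simp add: powr_mult[symmetric])
  have "d_exp \<alpha> * (a powr \<alpha> + b powr \<alpha> + c powr \<alpha>)
      = s powr \<alpha> * (d_exp \<alpha> * ((a / s) powr \<alpha> + (b / s) powr \<alpha> + (c / s) powr \<alpha>))"
    unfolding scale[OF nonneg(1)] scale[OF nonneg(2)] scale[OF nonneg(3)] by (simp only: distrib_left mult.left_commute)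
  also have "\<dots> \<le> s powr \<alpha>" using key s by (simp add: mult_left_le)
  finally show ?thesis by (simp add: s_def)
qed

lemma summable_exp_neg_powr:
  fixes c \<epsilon> \<alpha> :: real
  assumes "0 < c" "0 < \<epsilon>" "0 < \<alpha>"
  shows "summable (\<lambda>q. exp (- (c * (real q * \<epsilon>) powr \<alpha>)))"
proof (rule summable_comparison_test_bigo)
  show "summable (\<lambda>q. norm (1 / real q ^ 2))"
    using inverse_power_summable[of 2, where 'a = real] by (simp add: field_simps)
  show "(\<lambda>q. exp (- (c * (real q * \<epsilon>) powr \<alpha>))) \<in> O(\<lambda>q. 1 / real q ^ 2)"
    using assms by real_asymp
qed

text \<open>
  If the sequence gains \<open>\<epsilon>\<close> over every \<open>m\<close> steps, then \<open>y n \<ge> (n div m) * \<epsilon>\<close>, and every quotient is taken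
  by \<open>m\<close> indices. The step condition is confined to indices up to \<open>N\<close> because the spacings are
  controlled only inside the window.
\<close>
lemma sum_exp_neg_powr_le:
  fixes y :: "nat \<Rightarrow> real"
  assumes pos: "0 < c" "0 < \<epsilon>" "0 < \<alpha>" "0 < m"
    and y: "mono y" "0 \<le> y 0"
    and step: "\<And>n. n + m \<le> N \<Longrightarrow> y n + \<epsilon> \<le> y (n + m)"
  shows "(\<Sum>n\<le>N. exp (- (c * y n powr \<alpha>)))
    \<le> real m * (\<Sum>q. exp (- (c * (real q * \<epsilon>) powr \<alpha>)))"
proof -
  let ?g = "\<lambda>q::nat. exp (- (c * (real q * \<epsilon>) powr \<alpha>))"
  have block: "real q * \<epsilon> \<le> y (q * m)" if "q * m \<le> N" for q
    using that
  proof (induction q)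
    case 0
    then show ?case using y by simp
  next
    case (Suc q)
    then show ?case using step[of "q * m"] by (simp add: algebra_simps)
  qed
  have "exp (- (c * y n powr \<alpha>)) \<le> ?g (n div m)" if "n \<le> N" for n
  proof -
    have le: "n div m * m \<le> n" by simp
    have "real (n div m) * \<epsilon> \<le> y n"
      using block[of "n div m"] monoD[OF y(1) le] le that by linarith
    then show ?thesis using pos by (simp add: powr_mono2)
  qed
  then have "(\<Sum>n\<le>N. exp (- (c * y n powr \<alpha>))) \<le> (\<Sum>n\<le>N. ?g (n div m))"
    by (intro sum_mono) auto
  also have "\<dots> \<le> (\<Sum>n<Suc N * m. ?g (n div m))"
  proof (rule sum_mono2)
    show "{..N} \<subseteq> {..<Suc N * m}"
    proof
      fix n assume "n \<in> {..N}"
      then have "n < Suc N" by auto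
      also have "Suc N \<le> Suc N * m" using pos(4) mult_le_mono2[of 1 m "Suc N"] by simp
      finally show "n \<in> {..<Suc N * m}" by simp
    qed
  qed auto
  also have "\<dots> = (\<Sum>q<Suc N. \<Sum>n\<in>{q * m..<q * m + m}. ?g (n div m))"
    by (rule sum.nat_group[symmetric])
  also have "\<dots> = (\<Sum>q<Suc N. \<Sum>n\<in>{q * m..<q * m + m}. ?g q)"
  proof (intro sum.cong refl)
    fix q n assume "n \<in> {q * m..<q * m + m}"
    then have "n div m = q" by (intro div_nat_eqI) (auto simp: algebra_simps)
    then show "?g (n div m) = ?g q" by simp
  qed
  also have "\<dots> = real m * (\<Sum>q<Suc N. ?g q)" by (simp add: sum_distrib_left distrib_left)
  also have "\<dots> \<le> real m * (\<Sum>q. ?g q)"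
    using pos by (intro mult_left_mono sum_le_suminf summable_exp_neg_powr) auto
  finally show ?thesis .
qed

section \<open>The isoperimetric constant of a finite configuration\<close>

lemma points_in_window:
  assumes "{i::int. x i \<in> window L} = {a..b}"
  shows "range x \<inter> window L = x ` {a..b}"
  using assms by auto

lemma max_gap_eq:
  assumes "{i::int. x i \<in> window L} = {a..b}"
  shows "max_gap x L = Max ((\<lambda>k. x (k + 1) - x k) ` {a..<b})"
proof -
  have "(x k \<in> range x \<inter> window L \<and> x (k + 1) \<in> range x \<inter> window L) \<longleftrightarrow> k \<in> {a..<b}" for k
  proof -
    have "x k \<in> window L \<longleftrightarrow> k \<in> {a..b}" "x (k + 1) \<in> window L \<longleftrightarrow> k + 1 \<in> {a..b}"
      using assms by blast+
    then show ?thesis by auto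
  qed
  then show ?thesis unfolding max_gap_def by (simp add: image_def Bex_def conj_commute)
qed

lemma finite_cuts: "finite S \<Longrightarrow> finite {U. U \<noteq> {} \<and> U \<subseteq> S \<and> P U}"
  by (rule finite_subset[of _ "Pow S"]) auto

text \<open>
  Walking through the window from left to right, membership in an admissible \<open>U\<close> has to change
  somewhere, and the pair of neighbours at that place already contributes enough to the boundary sum.
\<close>
lemma cheeger_ge:
  fixes x :: "int \<Rightarrow> real"
  assumes inj: "strict_mono x" and window: "{i. x i \<in> window L} = {a..b}" and "a < b"
    and \<alpha>: "0 < \<alpha>"
  shows "1 / real_of_int (b - a + 1) * exp (- (max_gap x L powr \<alpha>)) \<le> cheeger \<alpha> (range x) L"
proof -
  let ?S = "x ` {a..b}"
  let ?N = "real_of_int (b - a + 1)"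
  have S: "range x \<inter> window L = ?S" using points_in_window[OF window] .
  have inj': "inj x" using inj by (rule strict_mono_imp_inj_on)
  have card: "real (card ?S) = ?N"
    using card_image[OF inj_on_subset[OF inj' subset_UNIV], of "{a..b}"] \<open>a < b\<close> by simp
  let ?A = "{U. U \<noteq> {} \<and> U \<subseteq> ?S \<and> real (card U) \<le> 1 / 2 * real (card ?S)}"
  have fin: "finite ?A" by (rule finite_cuts) simp
  have ne: "?A \<noteq> {}"
  proof -
    have "{x a} \<in> ?A" using \<open>a < b\<close> card by auto
    then show ?thesis by blast
  qed
  have "1 / ?N * exp (- (max_gap x L powr \<alpha>)) \<le> iso_ratio \<alpha> (range x) L U" if U: "U \<in> ?A" for U
  proof -
    have finU: "finite U" using U by (auto intro: finite_subset)
    have cU: "0 < card U" "real (card U) \<le> ?N" using U finU card \<open>a < b\<close> by (auto simp: card_gt_0_iff)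
    have proper: "U \<noteq> ?S" using U card \<open>a < b\<close> by auto
    \<comment> \<open>Otherwise membership is constant along the window, so that U is empty or everything.\<close>
    have "\<exists>i\<in>{a..<b}. (x i \<in> U) \<noteq> (x (i + 1) \<in> U)"
    proof (rule ccontr)
      assume same: "\<not> (\<exists>i\<in>{a..<b}. (x i \<in> U) \<noteq> (x (i + 1) \<in> U))"
      have const: "i \<le> b \<longrightarrow> (x i \<in> U) = (x a \<in> U)" if "a \<le> i" for i
        using that
      proof (induction rule: int_ge_induct)
        case (step i)
        then show ?case using same by (metis add_le_imp_le_right atLeastLessThan_iff zless_imp_add1_zle add1_zle_eq less_imp_le)
      qed simp
      from U obtain i where "i \<in> {a..b}" "x i \<in> U" by blast
      with const[of i] have "x a \<in> U" by simp
      with const have "?S \<subseteq> U" by auto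
      with U proper show False by blast
    qed
    then obtain i where i: "i \<in> {a..<b}" "(x i \<in> U) \<noteq> (x (i + 1) \<in> U)" by blast
    obtain u v where uv: "u \<in> U" "v \<in> ?S - U" "\<bar>u - v\<bar> = x (i + 1) - x i"
    proof -
      have "x i < x (i + 1)" using inj by (simp add: strict_mono_def)
      then show ?thesis using i that[of "x i" "x (i + 1)"] that[of "x (i + 1)" "x i"] by auto
    qed
    have "x (i + 1) - x i \<le> max_gap x L"
      unfolding max_gap_eq[OF window] using i by (intro Max_ge) auto
    moreover have "0 \<le> x (i + 1) - x i" using uv(3) abs_ge_zero by metis
    ultimately have "exp (- (max_gap x L powr \<alpha>)) \<le> exp (- (\<bar>u - v\<bar> powr \<alpha>))"
      using \<alpha> uv(3) by (simp add: powr_mono2)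
    also have "\<dots> \<le> (\<Sum>y\<in>?S - U. exp (- (\<bar>u - y\<bar> powr \<alpha>)))"
      using uv by (intro member_le_sum[of v _ "\<lambda>y. exp (- (\<bar>u - y\<bar> powr \<alpha>))"]) auto
    also have "\<dots> \<le> (\<Sum>x\<in>U. \<Sum>y\<in>?S - U. exp (- (\<bar>x - y\<bar> powr \<alpha>)))"
      using uv finU
      by (intro member_le_sum[of u _ "\<lambda>x. \<Sum>y\<in>?S - U. exp (- (\<bar>x - y\<bar> powr \<alpha>))"] sum_nonneg) auto
    finally show ?thesis
      unfolding iso_ratio_def S using cU by (intro mult_mono) (auto simp: frac_le)
  qed
  then show ?thesis
    unfolding cheeger_def S using fin ne by (subst Min_ge_iff) auto
qed

text \<open>
  The distance across the cut splits into the gap and the distances of the two points from its ends, so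
  \<open>d_exp_superadditive\<close> bounds the double sum by a product of two one-sided sums.
\<close>
lemma cut_energy_le:
  fixes x :: "int \<Rightarrow> real"
  assumes mono: "strict_mono x" and \<alpha>: "0 < \<alpha>" and k: "k \<in> {a..<b}"
    and "0 < \<epsilon>" "0 < m"
    and spread: "\<And>i. a \<le> i \<Longrightarrow> i + int m \<le> b \<Longrightarrow> x i + \<epsilon> \<le> x (i + int m)"
  shows "(\<Sum>i\<in>{a..k}. \<Sum>j\<in>{k+1..b}. exp (- ((x j - x i) powr \<alpha>)))
    \<le> (real m * (\<Sum>q. exp (- (d_exp \<alpha> * (real q * \<epsilon>) powr \<alpha>))))\<^sup>2
      * exp (- (d_exp \<alpha> * (x (k + 1) - x k) powr \<alpha>))"
proof -
  let ?d = "d_exp \<alpha>" and ?S = "\<Sum>q. exp (- (d_exp \<alpha> * (real q * \<epsilon>) powr \<alpha>))"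
  have le: "x i \<le> x j" if "i \<le> j" for i j using mono that by (simp add: strict_mono_less_eq)
  let ?l = "\<lambda>i. exp (- (?d * (x k - x i) powr \<alpha>))" and ?r = "\<lambda>j. exp (- (?d * (x j - x (k + 1)) powr \<alpha>))"
  let ?g = "exp (- (?d * (x (k + 1) - x k) powr \<alpha>))"
  have "exp (- ((x j - x i) powr \<alpha>)) \<le> ?g * (?l i * ?r j)" if "i \<in> {a..k}" "j \<in> {k+1..b}" for i j
    using d_exp_superadditive[OF \<alpha>, of "x (k + 1) - x k" "x k - x i" "x j - x (k + 1)"] that le
    by (simp add: exp_add[symmetric] algebra_simps)
  then have "(\<Sum>i\<in>{a..k}. \<Sum>j\<in>{k+1..b}. exp (- ((x j - x i) powr \<alpha>)))
      \<le> (\<Sum>i\<in>{a..k}. \<Sum>j\<in>{k+1..b}. ?g * (?l i * ?r j))"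
    by (intro sum_mono) auto
  also have "\<dots> = ?g * ((\<Sum>i\<in>{a..k}. ?l i) * (\<Sum>j\<in>{k+1..b}. ?r j))"
    unfolding sum_product by (simp add: sum_distrib_left)
  also have "\<dots> \<le> ?g * ((real m * ?S) * (real m * ?S))"
  proof (intro mult_left_mono mult_mono)
    have "(\<Sum>i\<in>{a..k}. ?l i) = (\<Sum>n\<le>nat (k - a). exp (- (?d * (x k - x (k - int n)) powr \<alpha>)))"
      by (rule sum.reindex_bij_witness[of _ "\<lambda>n. k - int n" "\<lambda>i. nat (k - i)"]) (use k in auto)
    also have "\<dots> \<le> real m * ?S"
    proof (rule sum_exp_neg_powr_le)
      fix n assume "n + m \<le> nat (k - a)"
      then have "x (k - int (n + m)) + \<epsilon> \<le> x (k - int (n + m) + int m)"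
        using k by (intro spread) auto
      then show "x k - x (k - int n) + \<epsilon> \<le> x k - x (k - int (n + m))" by simp
    qed (use assms d_exp_pos in \<open>auto simp: mono_def intro!: le\<close>)
    finally show "(\<Sum>i\<in>{a..k}. ?l i) \<le> real m * ?S" .
    have "(\<Sum>j\<in>{k+1..b}. ?r j) = (\<Sum>n\<le>nat (b - k - 1). exp (- (?d * (x (k + 1 + int n) - x (k + 1)) powr \<alpha>)))"
      by (rule sum.reindex_bij_witness[of _ "\<lambda>n. k + 1 + int n" "\<lambda>i. nat (i - k - 1)"]) (use k in auto)
    also have "\<dots> \<le> real m * ?S"
    proof (rule sum_exp_neg_powr_le)
      fix n assume "n + m \<le> nat (b - k - 1)"
      then have "x (k + 1 + int n) + \<epsilon> \<le> x (k + 1 + int n + int m)"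
        using k by (intro spread) auto
      then show "x (k + 1 + int n) - x (k + 1) + \<epsilon> \<le> x (k + 1 + int (n + m)) - x (k + 1)"
        by (simp add: algebra_simps)
    qed (use assms d_exp_pos in \<open>auto simp: mono_def intro!: le\<close>)
    finally show "(\<Sum>j\<in>{k+1..b}. ?r j) \<le> real m * ?S" .
  qed (auto intro!: sum_nonneg mult_nonneg_nonneg suminf_nonneg summable_exp_neg_powr simp: d_exp_pos assms)
  finally show ?thesis by (simp add: power2_eq_square mult.commute mult.left_commute)
qed

text \<open>
  Whichever side of the gap has at most half of the points is admissible, and its boundary sum is the same
  as that of its complement; \<open>t\<close> bounds the number of points of both sides from below, so it
  is immaterial which side is taken.
\<close>
lemma cheeger_le_cut:
  fixes x :: "int \<Rightarrow> real"
  assumes mono: "strict_mono x" and window: "{i. x i \<in> window L} = {a..b}" and k: "k \<in> {a..<b}"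
    and t: "0 < t" "t \<le> real_of_int (k - a + 1)" "t \<le> real_of_int (b - k)"
  shows "cheeger \<alpha> (range x) L
    \<le> 1 / t * (\<Sum>i\<in>{a..k}. \<Sum>j\<in>{k+1..b}. exp (- ((x j - x i) powr \<alpha>)))"
proof -
  let ?S = "x ` {a..b}" and ?W = "\<Sum>i\<in>{a..k}. \<Sum>j\<in>{k+1..b}. exp (- ((x j - x i) powr \<alpha>))"
  have S: "range x \<inter> window L = ?S" using points_in_window[OF window] .
  have inj: "inj_on x A" for A using strict_mono_imp_inj_on[OF mono] inj_on_subset by blast
  let ?A = "{U. U \<noteq> {} \<and> U \<subseteq> ?S \<and> real (card U) \<le> 1 / 2 * real (card ?S)}"
  have fin: "finite ?A" by (rule finite_cuts) simp
  have le: "x i \<le> x j" if "i \<le> j" for i j using mono that by (simp add: strict_mono_less_eq)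
  have cut: "cheeger \<alpha> (range x) L \<le> 1 / t * ?W"
    if J: "J \<noteq> {}" "J \<subseteq> {a..b}" "2 * card J \<le> card {a..b}" "t \<le> real (card J)"
      and E: "(\<Sum>i\<in>J. \<Sum>j\<in>{a..b} - J. exp (- (\<bar>x i - x j\<bar> powr \<alpha>))) = ?W" for J
  proof -
    have "x ` J \<in> ?A" using J by (auto simp: card_image[OF inj])
    then have "cheeger \<alpha> (range x) L \<le> iso_ratio \<alpha> (range x) L (x ` J)"
      unfolding cheeger_def S using fin by (intro Min_le) auto
    also have "\<dots> = 1 / real (card J) * ?W"
    proof -
      have "?S - x ` J = x ` ({a..b} - J)" using image_set_diff[OF strict_mono_imp_inj_on[OF mono]] by auto
      then show ?thesis
        unfolding iso_ratio_def S E[symmetric] by (simp add: card_image[OF inj] sum.reindex[OF inj])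
    qed
    also have "\<dots> \<le> 1 / t * ?W"
      using J t by (intro mult_right_mono sum_nonneg) (auto simp: frac_le)
    finally show ?thesis .
  qed
  have cards: "card {a..k} + card {k+1..b} = card {a..b}" using k by auto
  show ?thesis
  proof (cases "card {a..k} \<le> card {k+1..b}")
    case True
    show ?thesis
    proof (rule cut[of "{a..k}"])
      have D: "{a..b} - {a..k} = {k+1..b}" using k by auto
      show "(\<Sum>i\<in>{a..k}. \<Sum>j\<in>{a..b} - {a..k}. exp (- (\<bar>x i - x j\<bar> powr \<alpha>))) = ?W"
        unfolding D by (intro sum.cong refl) (use le in \<open>auto simp: abs_minus_commute[of "x _" "x _"]\<close>)
    qed (use k t True cards in auto)
  next
    case False
    show ?thesis
    proof (rule cut[of "{k+1..b}"])
      have D: "{a..b} - {k+1..b} = {a..k}" using k by auto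
      show "(\<Sum>i\<in>{k+1..b}. \<Sum>j\<in>{a..b} - {k+1..b}. exp (- (\<bar>x i - x j\<bar> powr \<alpha>))) = ?W"
        unfolding D by (subst sum.swap) (intro sum.cong refl, use le in auto)
    qed (use k t False cards in auto)
  qed
qed

section \<open>Counting points of a linearly growing sequence\<close>

lemma linear_growth_along_floor:
  fixes y :: "nat \<Rightarrow> real"
  assumes lim: "(\<lambda>n. y n / real n) \<longlonglongrightarrow> \<mu>" and p: "0 < p"
  shows "(\<lambda>n. y (nat \<lfloor>p * real n\<rfloor>) / real n) \<longlonglongrightarrow> p * \<mu>"
proof -
  let ?k = "\<lambda>n. nat \<lfloor>p * real n\<rfloor>"
  have k: "filterlim ?k at_top sequentially" using p by real_asymp
  have ratio: "(\<lambda>n. real (?k n) / real n) \<longlonglongrightarrow> p" using p by real_asymp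
  have "(\<lambda>n. (real (?k n) / real n) * (y (?k n) / real (?k n))) \<longlonglongrightarrow> p * \<mu>"
    by (intro tendsto_mult ratio filterlim_compose[OF lim k])
  moreover have "\<forall>\<^sub>F n in sequentially. 0 < ?k n"
    using filterlim_at_top[THEN iffD1, OF k] by (simp only: Suc_le_eq[symmetric])
  then have "\<forall>\<^sub>F n in sequentially. (real (?k n) / real n) * (y (?k n) / real (?k n)) = y (?k n) / real n"
  proof eventually_elim
    case (elim n)
    have cancel: "a / b * (c / a) = c / b" if "a \<noteq> 0" for a b c :: real using that by simp
    show ?case by (rule cancel) (use elim in linarith)
  qed
  ultimately show ?thesis by (simp add: tendsto_cong)
qed

text \<open>
  Evaluating \<open>y n / n \<longlonglongrightarrow> \<mu>\<close> along \<open>\<lfloor>p n\<rfloor>\<close> locates \<open>y\<close> at that index near \<open>p \<mu> n\<close>. The indices \<open>k\<close> and \<open>l\<close> witness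
  that the margin between \<open>\<gamma> n / 2\<close> and \<open>n / 2\<close> holds a positive fraction of \<open>n\<close> points.
\<close>
lemma linear_growth_counting:
  fixes y :: "nat \<Rightarrow> real"
  assumes mono: "strict_mono y" and lim: "(\<lambda>n. y n / real n) \<longlonglongrightarrow> \<mu>" and \<mu>: "0 < \<mu>"
    and \<gamma>: "0 < \<gamma>" "\<gamma> < 1"
  shows "\<forall>\<^sub>F n in sequentially.
      (\<forall>k. y k \<le> real n / 2 \<longrightarrow> real k \<le> real n / \<mu>) \<and>
      (\<exists>k l. \<gamma> * real n / 2 < y k \<and> y l \<le> real n / 2 \<and> k \<le> l \<and> (1 - \<gamma>) / (12 * \<mu>) * real n \<le> real l - real k)"
proof -
  \<comment> \<open>The interval from \<gamma> / (2 \<mu>) to 1 / (2 \<mu>) is divided in three: p and q are the inner points of division.\<close>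
  define p q where "p = (1 + 2 * \<gamma>) / (6 * \<mu>)" and "q = (2 + \<gamma>) / (6 * \<mu>)"
  have pq: "0 < p" "0 < q" and qp: "q - p = (1 - \<gamma>) / (6 * \<mu>)"
    using \<gamma> \<mu> by (simp_all add: p_def q_def diff_divide_distrib[symmetric])
  have vals: "p * \<mu> = (1 + 2 * \<gamma>) / 6" "q * \<mu> = (2 + \<gamma>) / 6" "1 / \<mu> * \<mu> = 1"
    using \<mu> by (simp_all add: p_def q_def)
  have "\<forall>\<^sub>F n in sequentially. 1 / 2 < y (nat \<lfloor>1 / \<mu> * real n\<rfloor>) / real n"
    by (rule order_tendstoD[OF linear_growth_along_floor[OF lim]]) (use \<mu> vals in auto)
  moreover have "\<forall>\<^sub>F n in sequentially. \<gamma> / 2 < y (nat \<lfloor>p * real n\<rfloor>) / real n"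
    by (rule order_tendstoD[OF linear_growth_along_floor[OF lim]]) (use \<gamma> pq vals in auto)
  moreover have "\<forall>\<^sub>F n in sequentially. y (nat \<lfloor>q * real n\<rfloor>) / real n < 1 / 2"
    by (rule order_tendstoD[OF linear_growth_along_floor[OF lim]]) (use \<gamma> pq vals in auto)
  moreover have "\<forall>\<^sub>F n in sequentially. (q - p) / 2 * real n \<ge> 1"
    using \<gamma> \<mu> unfolding qp by real_asymp
  moreover have "\<forall>\<^sub>F n::nat in sequentially. 0 < n" by (rule eventually_gt_at_top)
  ultimately show ?thesis
  proof eventually_elim
    case (elim n)
    have "real k \<le> real n / \<mu>" if "y k \<le> real n / 2" for k
    proof -
      have "y k < y (nat \<lfloor>1 / \<mu> * real n\<rfloor>)" using elim that by (simp add: field_simps)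
      then have "k < nat \<lfloor>1 / \<mu> * real n\<rfloor>" using mono by (simp add: strict_mono_less)
      then have "int k \<le> \<lfloor>1 / \<mu> * real n\<rfloor>" by linarith
      then have "real_of_int (int k) \<le> 1 / \<mu> * real n" by (simp add: le_floor_iff)
      then show ?thesis by simp
    qed
    moreover have "\<gamma> * real n / 2 < y (nat \<lfloor>p * real n\<rfloor>)" "y (nat \<lfloor>q * real n\<rfloor>) \<le> real n / 2"
      using elim by (simp_all add: field_simps)
    moreover have "real (nat \<lfloor>q * real n\<rfloor>) - real (nat \<lfloor>p * real n\<rfloor>) \<ge> (q - p) / 2 * real n"
    proof -
      have "real (nat \<lfloor>q * real n\<rfloor>) \<ge> q * real n - 1"
        by linarith
      moreover have "real (nat \<lfloor>p * real n\<rfloor>) \<le> p * real n"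
        using pq by (intro of_nat_floor) auto
      moreover have "(q - p) * real n = q * real n - p * real n" by (simp add: algebra_simps)
      ultimately show ?thesis using elim(4) by linarith
    qed
    moreover from this elim(4) have "nat \<lfloor>p * real n\<rfloor> \<le> nat \<lfloor>q * real n\<rfloor>" by linarith
    moreover have "(q - p) / 2 = (1 - \<gamma>) / (12 * \<mu>)" by (simp add: qp)
    ultimately show ?case by metis
  qed
qed

section \<open>Bounds for a configuration of linear growth\<close>

lemma index_interval:
  fixes x :: "int \<Rightarrow> real"
  assumes mono: "strict_mono x" and x0: "x 0 \<in> window L"
    and bound: "\<And>k. x k \<in> window L \<Longrightarrow> \<bar>k\<bar> \<le> K"
  obtains a b where "{k. x k \<in> window L} = {a..b}"
proof -
  let ?I = "{k. x k \<in> window L}"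
  have sub: "?I \<subseteq> {-K..K}" using bound by (force simp: abs_le_iff)
  then have fin: "finite ?I" by (rule finite_subset) simp
  have ne: "?I \<noteq> {}" using x0 by auto
  have "k \<in> ?I" if "Min ?I \<le> k" "k \<le> Max ?I" for k
  proof -
    have "x (Min ?I) \<le> x k" "x k \<le> x (Max ?I)" using that mono by (auto simp: strict_mono_less_eq)
    moreover have "x (Min ?I) \<in> window L" "x (Max ?I) \<in> window L" using Min_in[OF fin ne] Max_in[OF fin ne] by auto
    ultimately show ?thesis by (auto simp: window_def)
  qed
  moreover have "Min ?I \<le> k" "k \<le> Max ?I" if "k \<in> ?I" for k
    using that fin by auto
  ultimately have "?I = {Min ?I..Max ?I}" by (meson atLeastAtMost_iff subsetI subset_antisym)
  then show ?thesis using that by blast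
qed

text \<open>
  The constant is chosen before the configuration, as it has to be deterministic when the configuration is
  random. Indices of points in the window are at most \<open>n / \<mu>\<close> in absolute value, so the blocks have to be
  long only for those indices.
\<close>
lemma cheeger_bounds:
  fixes \<mu> \<gamma> \<epsilon> \<alpha> :: real
  assumes \<mu>: "0 < \<mu>" and \<gamma>: "0 < \<gamma>" "\<gamma> < 1" and \<epsilon>: "0 < \<epsilon>" and \<alpha>: "0 < \<alpha>"
  shows "\<exists>C>0. \<forall>x m. strict_mono x \<longrightarrow> x 0 = 0 \<longrightarrow>
      (\<lambda>n. x (int n) / real n) \<longlonglongrightarrow> \<mu> \<longrightarrow> (\<lambda>n. - x (- int n) / real n) \<longlonglongrightarrow> \<mu> \<longrightarrow>
      (\<forall>\<^sub>F n in sequentially. 0 < m n \<and>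
        (\<forall>i. \<bar>real_of_int i\<bar> \<le> real n / \<mu> \<longrightarrow> x i + \<epsilon> \<le> x (i + int (m n)))) \<longrightarrow>
      (\<forall>\<^sub>F n in sequentially.
        1 / (C * real n) * exp (- (max_gap x (real n) powr \<alpha>)) \<le> cheeger \<alpha> (range x) (real n) \<and>
        cheeger \<alpha> (range x) (real n)
          \<le> C * (real (m n))\<^sup>2 / real n * exp (- (d_exp \<alpha> * max_gap x (\<gamma> * real n) powr \<alpha>)))"
proof -
  define S where "S = (\<Sum>q. exp (- (d_exp \<alpha> * (real q * \<epsilon>) powr \<alpha>)))"
  define c where "c = (1 - \<gamma>) / (12 * \<mu>)"
  define C where "C = max (2 / \<mu> + 1) (S\<^sup>2 / c)"
  have c: "0 < c" using \<mu> \<gamma> by (simp add: c_def)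
  have C: "0 < C" "2 / \<mu> + 1 \<le> C" "S\<^sup>2 / c \<le> C" using \<mu> by (simp_all add: C_def less_max_iff_disj add_pos_pos)
  have "\<forall>\<^sub>F n in sequentially.
        1 / (C * real n) * exp (- (max_gap x (real n) powr \<alpha>)) \<le> cheeger \<alpha> (range x) (real n) \<and>
        cheeger \<alpha> (range x) (real n)
          \<le> C * (real (m n))\<^sup>2 / real n * exp (- (d_exp \<alpha> * max_gap x (\<gamma> * real n) powr \<alpha>))"
    if mono: "strict_mono x" and x0: "x 0 = 0"
      and right: "(\<lambda>n. x (int n) / real n) \<longlonglongrightarrow> \<mu>" and left: "(\<lambda>n. - x (- int n) / real n) \<longlonglongrightarrow> \<mu>"
      and spread: "\<forall>\<^sub>F n in sequentially. 0 < m n \<and>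
        (\<forall>i. \<bar>real_of_int i\<bar> \<le> real n / \<mu> \<longrightarrow> x i + \<epsilon> \<le> x (i + int (m n)))" for x m
  proof -
    have "strict_mono (\<lambda>n. x (int n))" "strict_mono (\<lambda>n. - x (- int n))"
      using mono by (auto simp: strict_mono_def)
    from linear_growth_counting[OF this(1) right \<mu> \<gamma>] linear_growth_counting[OF this(2) left \<mu> \<gamma>]
    have "\<forall>\<^sub>F n in sequentially.
      (\<forall>k. x (int k) \<le> real n / 2 \<longrightarrow> real k \<le> real n / \<mu>) \<and>
      (\<exists>k l. \<gamma> * real n / 2 < x (int k) \<and> x (int l) \<le> real n / 2 \<and> k \<le> l \<and> c * real n \<le> real l - real k) \<and>
      (\<forall>k. - x (- int k) \<le> real n / 2 \<longrightarrow> real k \<le> real n / \<mu>) \<and>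
      (\<exists>k l. \<gamma> * real n / 2 < - x (- int k) \<and> - x (- int l) \<le> real n / 2 \<and> k \<le> l \<and> c * real n \<le> real l - real k)"
      unfolding c_def[symmetric] by eventually_elim blast
    moreover have "\<forall>\<^sub>F n in sequentially. x 1 \<le> \<gamma> * real n / 2" using \<gamma> by real_asymp
    moreover have "\<forall>\<^sub>F n::nat in sequentially. 1 \<le> n" by (rule eventually_ge_at_top)
    ultimately show ?thesis using spread
    proof eventually_elim
      case (elim n)
      let ?L = "real n"
      have n: "1 \<le> ?L" using elim by simp
      have window: "x k \<in> window r \<longleftrightarrow> x k \<le> r / 2 \<and> - x k \<le> r / 2" for k r by (auto simp: window_def)
      have less: "x i < x j \<longleftrightarrow> i < j" for i j using mono by (simp add: strict_mono_less)
      have le: "x i \<le> x j \<longleftrightarrow> i \<le> j" for i j using mono by (simp add: strict_mono_less_eq)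
      have bound: "\<bar>real_of_int k\<bar> \<le> ?L / \<mu>" if "x k \<in> window ?L" for k
      proof (cases "0 \<le> k")
        case True
        then show ?thesis using elim(1) that by (auto simp: window dest: spec[of _ "nat k"])
      next
        case False
        then show ?thesis using elim(1) that
          by (auto simp: window dest: spec[of _ "nat (- k)"])
      qed
      have x1: "0 < x 1" using less[of 0 1] x0 by simp
      have \<gamma>L: "\<gamma> * ?L \<le> ?L" using \<gamma> by (simp add: mult_left_le_one_le)
      obtain a b where ab: "{k. x k \<in> window ?L} = {a..b}"
      proof (rule index_interval[OF mono])
        show "\<bar>k\<bar> \<le> \<lfloor>?L / \<mu>\<rfloor>" if "x k \<in> window ?L" for k
          using bound[OF that] by (simp add: le_floor_iff)
        show "x 0 \<in> window ?L" using x0 by (simp add: window_def)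
      qed (rule that)
      obtain a' b' where ab': "{k. x k \<in> window (\<gamma> * ?L)} = {a'..b'}"
      proof (rule index_interval[OF mono])
        have "x k \<in> window ?L" if "x k \<in> window (\<gamma> * ?L)" for k
          using that \<gamma>L by (auto simp: window)
        then show "\<bar>k\<bar> \<le> \<lfloor>?L / \<mu>\<rfloor>" if "x k \<in> window (\<gamma> * ?L)" for k
          using bound that by (simp add: le_floor_iff)
        show "x 0 \<in> window (\<gamma> * ?L)" using x0 \<gamma> by (simp add: window_def)
      qed (rule that)
      have in_ab: "x k \<in> window ?L \<longleftrightarrow> a \<le> k \<and> k \<le> b" for k using ab by auto
      have in_ab': "x k \<in> window (\<gamma> * ?L) \<longleftrightarrow> a' \<le> k \<and> k \<le> b'" for k using ab' by auto
      have "x 0 \<in> window (\<gamma> * ?L)" "x 1 \<in> window (\<gamma> * ?L)"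
        using x0 x1 elim(2) \<gamma> by (auto simp: window_def)
      then have ab'01: "a' \<le> 0" "1 \<le> b'" by (auto simp: in_ab')
      have "x 0 \<in> window ?L" "x 1 \<in> window ?L"
        using x0 x1 elim(2) \<gamma>L by (auto simp: window_def)
      then have ab01: "a \<le> 0" "1 \<le> b" by (auto simp: in_ab)
      have abK: "\<bar>real_of_int a\<bar> \<le> ?L / \<mu>" "\<bar>real_of_int b\<bar> \<le> ?L / \<mu>"
        using ab01 bound[of a] bound[of b] in_ab[of a] in_ab[of b] by auto
      have size: "real_of_int (b - a + 1) \<le> C * ?L"
      proof -
        have "real_of_int (b - a + 1) \<le> ?L / \<mu> + ?L / \<mu> + ?L" using abK n by linarith
        also have "\<dots> = (2 / \<mu> + 1) * ?L" by (simp add: field_simps)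
        also have "\<dots> \<le> C * ?L" using C by (intro mult_right_mono) auto
        finally show ?thesis .
      qed
      have "1 / (C * ?L) * exp (- (max_gap x ?L powr \<alpha>))
          \<le> 1 / real_of_int (b - a + 1) * exp (- (max_gap x ?L powr \<alpha>))"
        using size ab01 by (intro mult_right_mono frac_le) auto
      also have "\<dots> \<le> cheeger \<alpha> (range x) ?L"
        using ab01 by (intro cheeger_ge[OF mono ab _ \<alpha>]) auto
      finally have lower: "1 / (C * ?L) * exp (- (max_gap x ?L powr \<alpha>)) \<le> cheeger \<alpha> (range x) ?L" .
      obtain k where k: "k \<in> {a'..<b'}" "max_gap x (\<gamma> * ?L) = x (k + 1) - x k"
      proof -
        have "max_gap x (\<gamma> * ?L) \<in> (\<lambda>k. x (k + 1) - x k) ` {a'..<b'}"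
          unfolding max_gap_eq[OF ab'] using ab'01 by (intro Max_in) auto
        then show ?thesis using that by blast
      qed
      have xk: "- x k \<le> \<gamma> * ?L / 2" "x (k + 1) \<le> \<gamma> * ?L / 2"
        using k(1) in_ab'[of k] in_ab'[of "k + 1"] by (auto simp: window)
      obtain r s where rs: "\<gamma> * ?L / 2 < x (int r)" "x (int s) \<le> ?L / 2" "r \<le> s" "c * ?L \<le> real s - real r"
        using elim(1) by blast
      obtain u v where uv: "\<gamma> * ?L / 2 < - x (- int u)" "- x (- int v) \<le> ?L / 2" "u \<le> v" "c * ?L \<le> real v - real u"
        using elim(1) by blast
      \<comment> \<open>The right margin lies beyond the gap, which ends inside the inner window; likewise on the left.\<close>
      have "k + 1 < int r" using xk rs less[of "k + 1" "int r"] by linarith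
      moreover have "int s \<le> b"
        using in_ab[of "int s"] rs le[of 0 "int s"] x0 by (auto simp: window)
      ultimately have kb: "c * ?L \<le> real_of_int (b - k)" using rs by linarith
      have "- int u < k" using xk uv less[of "- int u" k] by linarith
      moreover have "a \<le> - int v"
        using in_ab[of "- int v"] uv le[of "- int v" 0] x0 by (auto simp: window)
      ultimately have ka: "c * ?L \<le> real_of_int (k - a + 1)" using uv by linarith
      have cL: "0 < c * ?L" using c n by simp
      have kab: "k \<in> {a..<b}" using ka kb cL by auto
      have "cheeger \<alpha> (range x) ?L
          \<le> 1 / (c * ?L) * (\<Sum>i\<in>{a..k}. \<Sum>j\<in>{k+1..b}. exp (- ((x j - x i) powr \<alpha>)))"
        by (rule cheeger_le_cut[OF mono ab kab cL ka kb])
      also have "\<dots> \<le> 1 / (c * ?L) * ((real (m n) * S)\<^sup>2 * exp (- (d_exp \<alpha> * (x (k + 1) - x k) powr \<alpha>)))"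
      proof (rule mult_left_mono)
        show "(\<Sum>i\<in>{a..k}. \<Sum>j\<in>{k+1..b}. exp (- ((x j - x i) powr \<alpha>)))
            \<le> (real (m n) * S)\<^sup>2 * exp (- (d_exp \<alpha> * (x (k + 1) - x k) powr \<alpha>))"
          unfolding S_def
        proof (rule cut_energy_le[OF mono \<alpha> kab \<epsilon>])
          fix i assume "a \<le> i" "i + int (m n) \<le> b"
          then show "x i + \<epsilon> \<le> x (i + int (m n))"
            using elim(4) bound[of i] in_ab[of i] by auto
        qed (use elim in auto)
      qed (use cL in auto)
      also have "\<dots> = S\<^sup>2 / c * ((real (m n))\<^sup>2 / ?L * exp (- (d_exp \<alpha> * max_gap x (\<gamma> * ?L) powr \<alpha>)))"
        unfolding k(2) by (simp add: power_mult_distrib)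
      also have "\<dots> \<le> C * ((real (m n))\<^sup>2 / ?L * exp (- (d_exp \<alpha> * max_gap x (\<gamma> * ?L) powr \<alpha>)))"
        using C by (intro mult_right_mono) auto
      finally show ?case using lower by simp
    qed
  qed
  then show ?thesis using C(1) by blast
qed

section \<open>The strong law of large numbers\<close>

text \<open>
  The maximum of \<open>\<Sum>i<k. y i\<close> over \<open>k \<le> n\<close>. The recursion splits off the first term rather than
  the last, because the drift argument compares the maximum for a sequence with that for its shift.
\<close>
fun max_partial_sum :: "nat \<Rightarrow> (nat \<Rightarrow> real) \<Rightarrow> real" where
  "max_partial_sum 0 y = 0"
| "max_partial_sum (Suc n) y = max 0 (y 0 + max_partial_sum n (\<lambda>i. y (Suc i)))"

lemma max_partial_sum_nonneg: "0 \<le> max_partial_sum n y"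
  by (cases n) auto

lemma max_partial_sum_mono: "max_partial_sum n y \<le> max_partial_sum (Suc n) y"
proof (induction n arbitrary: y)
  case (Suc n)
  from Suc[of "\<lambda>i. y (Suc i)"] show ?case by (simp only: max_partial_sum.simps(2))
qed simp

lemma sum_le_max_partial_sum: "k \<le> n \<Longrightarrow> (\<Sum>i<k. y i) \<le> max_partial_sum n y"
proof (induction n arbitrary: k y)
  case (Suc n)
  show ?case
  proof (cases k)
    case (Suc j)
    then show ?thesis
      using Suc.IH[of j "\<lambda>i. y (Suc i)"] Suc.prems by (simp add: sum.lessThan_Suc_shift del: sum.lessThan_Suc)
  qed simp
qed simp

lemma max_partial_sum_le: "max_partial_sum n y \<le> (\<Sum>i<n. \<bar>y i\<bar>)"
proof (induction n arbitrary: y)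
  case (Suc n)
  have "0 \<le> (\<Sum>i<n. \<bar>y (Suc i)\<bar>)" by (intro sum_nonneg) auto
  then show ?case using Suc[of "\<lambda>i. y (Suc i)"] by (simp add: sum.lessThan_Suc_shift del: sum.lessThan_Suc)
qed simp

lemma borel_measurable_max_partial_sum [measurable]:
  "(\<And>i. f i \<in> borel_measurable N) \<Longrightarrow> (\<lambda>\<omega>. max_partial_sum n (\<lambda>i. f i \<omega>)) \<in> borel_measurable N"
proof (induction n arbitrary: f)
  case (Suc n)
  have "(\<lambda>\<omega>. max_partial_sum n (\<lambda>i. f (Suc i) \<omega>)) \<in> borel_measurable N"
    using Suc.IH[of "\<lambda>i. f (Suc i)"] Suc.prems by simp
  then show ?case using Suc.prems by simp
qed simp

text \<open>
  The difference equals \<open>max (- M) (y 0)\<close> with \<open>M\<close> the maximum for the shifted sequence, and \<open>M\<close> eventually exceeds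
  \<open>\<bar>y 0\<bar>\<close> when the partial sums are unbounded.
\<close>
lemma max_partial_sum_shift_tendsto:
  assumes "\<And>B::nat. \<exists>k. real B < (\<Sum>i<k. y i)"
  shows "(\<lambda>n. max_partial_sum (Suc n) y - max_partial_sum n (\<lambda>i. y (Suc i))) \<longlonglongrightarrow> y 0"
proof (rule tendsto_eventually)
  obtain B :: nat where "\<bar>y 0\<bar> + \<bar>y 0\<bar> \<le> real B" using real_arch_simple by blast
  moreover obtain k where "real B < (\<Sum>i<k. y i)" using assms by blast
  moreover from calculation obtain j where "k = Suc j" by (cases k) auto
  ultimately have j: "\<bar>y 0\<bar> \<le> (\<Sum>i<j. y (Suc i))" by (simp add: sum.lessThan_Suc_shift del: sum.lessThan_Suc)
  show "\<forall>\<^sub>F n in sequentially. max_partial_sum (Suc n) y - max_partial_sum n (\<lambda>i. y (Suc i)) = y 0"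
    using eventually_ge_at_top[of j]
  proof eventually_elim
    case (elim n)
    then have "\<bar>y 0\<bar> \<le> max_partial_sum n (\<lambda>i. y (Suc i))"
      using j sum_le_max_partial_sum[of j n "\<lambda>i. y (Suc i)"] by linarith
    then show ?case by simp
  qed
qed

context prob_space
begin

lemma iid_sequence_distr_eq:
  fixes X Y :: "nat \<Rightarrow> 'a \<Rightarrow> real"
  assumes "indep_vars (\<lambda>_. borel) X UNIV" "indep_vars (\<lambda>_. borel) Y UNIV"
    and "\<And>i. distr M borel (X i) = distr M borel (Y i)"
  shows "distr M (PiM UNIV (\<lambda>_. borel)) (\<lambda>\<omega> i. X i \<omega>) = distr M (PiM UNIV (\<lambda>_. borel)) (\<lambda>\<omega> i. Y i \<omega>)"
proof -
  have "distr M (PiM UNIV (\<lambda>_. borel)) (\<lambda>\<omega>. \<lambda>i\<in>UNIV. X i \<omega>) = PiM UNIV (\<lambda>i. distr M borel (X i))"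
    using assms(1) by (subst indep_vars_iff_distr_eq_PiM[symmetric]) (auto simp: indep_vars_def)
  moreover have "distr M (PiM UNIV (\<lambda>_. borel)) (\<lambda>\<omega>. \<lambda>i\<in>UNIV. Y i \<omega>) = PiM UNIV (\<lambda>i. distr M borel (Y i))"
    using assms(2) by (subst indep_vars_iff_distr_eq_PiM[symmetric]) (auto simp: indep_vars_def)
  ultimately show ?thesis using assms(3) by (simp only: restrict_UNIV)
qed

lemma indep_vars_reindex:
  assumes indep: "indep_vars N X I" and f: "inj_on f J" "f ` J \<subseteq> I"
  shows "indep_vars (\<lambda>j. N (f j)) (\<lambda>j. X (f j)) J"
  unfolding indep_vars_def2 indep_sets_def
proof (intro conjI ballI allI impI)
  show "X (f j) \<in> measurable M (N (f j))" if "j \<in> J" for j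
    using indep f that by (auto simp: indep_vars_def2)
  then show "{X (f j) -` A \<inter> space M | A. A \<in> sets (N (f j))} \<subseteq> events" if "j \<in> J" for j
    using that by auto
  fix K A assume K: "K \<subseteq> J" "K \<noteq> {}" "finite K"
    and A: "A \<in> (\<Pi> j\<in>K. {X (f j) -` A \<inter> space M | A. A \<in> sets (N (f j))})"
  have inj: "inj_on f K" using f K inj_on_subset by blast
  let ?B = "\<lambda>i. A (the_inv_into K f i)"
  have B: "?B (f j) = A j" if "j \<in> K" for j using that inj by (simp add: the_inv_into_f_f)
  have "prob (\<Inter>i\<in>f ` K. ?B i) = (\<Prod>i\<in>f ` K. prob (?B i))"
  proof (rule indep_setsD)
    show "indep_sets (\<lambda>i. {X i -` A \<inter> space M | A. A \<in> sets (N i)}) I"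
      using indep by (simp add: indep_vars_def2)
    show "\<forall>i\<in>f ` K. ?B i \<in> {X i -` A \<inter> space M | A. A \<in> sets (N i)}"
      using A B by (auto simp: Pi_iff)
  qed (use K f in auto)
  moreover have "(\<Inter>i\<in>f ` K. ?B i) = (\<Inter>j\<in>K. A j)" using B by auto
  moreover have "(\<Prod>i\<in>f ` K. prob (?B i)) = (\<Prod>j\<in>K. prob (A j))"
    using B inj by (simp add: prod.reindex)
  ultimately show "prob (\<Inter>j\<in>K. A j) = (\<Prod>j\<in>K. prob (A j))" by simp
qed

text \<open>
  Dropping finitely many summands does not change whether the partial sums are unbounded, so this is
  a tail event and Kolmogorov's 0-1 law applies.
\<close>
lemma prob_unbounded_partial_sums_0_1:
  fixes Y :: "nat \<Rightarrow> 'a \<Rightarrow> real"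
  assumes indep: "indep_vars (\<lambda>_. borel) Y UNIV"
  defines "A \<equiv> {\<omega>\<in>space M. \<forall>B::nat. \<exists>k. real B < (\<Sum>i<k. Y i \<omega>)}"
  shows "prob A = 0 \<or> prob A = 1"
proof (rule kolmogorov_0_1_law)
  let ?G = "\<lambda>i. {Y i -` S \<inter> space M | S. S \<in> sets borel}"
  show "indep_sets (\<lambda>i. sigma_sets (space M) (?G i)) UNIV"
    using indep by (simp add: indep_vars_def)
  have sub: "?G i \<subseteq> Pow (space M)" for i by auto
  then show "sigma_algebra (space M) (sigma_sets (space M) (?G i))" for i
    by (rule sigma_algebra_sigma_sets)
  show "A \<in> tail_events (\<lambda>i. sigma_sets (space M) (?G i))"
    unfolding tail_events_def
  proof
    fix n :: nat
    let ?U = "\<Union>i\<in>{n..}. sigma_sets (space M) (?G i)"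
    have U: "?U \<subseteq> Pow (space M)" using sigma_sets_into_sp[OF sub] by blast
    define N where "N = sigma (space M) ?U"
    have space_N: "space N = space M" using U by (simp add: N_def space_measure_of)
    have sets_N: "sets N = sigma_sets (space M) ?U" using U by (simp add: N_def sets_measure_of)
    \<comment> \<open>N is the sigma-algebra generated by the variables from index n on.\<close>
    have [measurable]: "Y i \<in> borel_measurable N" if "n \<le> i" for i
    proof (rule measurableI)
      fix S :: "real set" assume "S \<in> sets borel"
      then have "Y i -` S \<inter> space M \<in> ?U" using that by (intro UN_I[of i] sigma_sets.Basic) auto
      then show "Y i -` S \<inter> space N \<in> sets N" unfolding sets_N space_N by (rule sigma_sets.Basic)
    qed simp
    have "(\<forall>B::nat. \<exists>k. real B < (\<Sum>i<k. Y i \<omega>)) \<longleftrightarrow> (\<forall>B::nat. \<exists>k. real B < (\<Sum>i\<in>{n..<n+k}. Y i \<omega>))" for \<omega>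
    proof -
      let ?s = "\<Sum>i<n. Y i \<omega>"
      have split: "(\<Sum>i<n+k. Y i \<omega>) = ?s + (\<Sum>i\<in>{n..<n+k}. Y i \<omega>)" for k
        by (simp add: lessThan_atLeast0 sum.atLeastLessThan_concat)
      show ?thesis
      proof (intro iffI allI)
        fix B :: nat assume unb: "\<forall>B::nat. \<exists>k. real B < (\<Sum>i<k. Y i \<omega>)"
        \<comment> \<open>This threshold is above every partial sum of length at most n, so only longer sums can exceed it.\<close>
        obtain B' :: nat where B': "real B + (\<Sum>i<n. \<bar>Y i \<omega>\<bar>) \<le> real B'" using real_arch_simple by blast
        obtain k where k: "real B' < (\<Sum>i<k. Y i \<omega>)" using unb by blast
        have "n \<le> k"
        proof (rule ccontr)
          assume "\<not> n \<le> k"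
          then have "(\<Sum>i<k. Y i \<omega>) \<le> (\<Sum>i<n. \<bar>Y i \<omega>\<bar>)"
            by (intro order_trans[OF sum_mono sum_mono2]) auto
          then show False using k B' by simp
        qed
        then have "real B' < ?s + (\<Sum>i\<in>{n..<n+(k-n)}. Y i \<omega>)" using split[of "k - n"] k by simp
        moreover have "?s \<le> (\<Sum>i<n. \<bar>Y i \<omega>\<bar>)" by (intro sum_mono) auto
        ultimately show "\<exists>k. real B < (\<Sum>i\<in>{n..<n+k}. Y i \<omega>)" using B' by (intro exI[of _ "k - n"]) linarith
      next
        fix B :: nat assume unb: "\<forall>B::nat. \<exists>k. real B < (\<Sum>i\<in>{n..<n+k}. Y i \<omega>)"
        obtain B' :: nat where "real B - ?s \<le> real B'" using real_arch_simple by blast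
        moreover obtain k where "real B' < (\<Sum>i\<in>{n..<n+k}. Y i \<omega>)" using unb by blast
        ultimately have "real B < (\<Sum>i<n+k. Y i \<omega>)" using split[of k] by simp
        then show "\<exists>k. real B < (\<Sum>i<k. Y i \<omega>)" by blast
      qed
    qed
    then have A: "A = {\<omega>\<in>space N. \<forall>B::nat. \<exists>k. real B < (\<Sum>i\<in>{n..<n+k}. Y i \<omega>)}"
      by (simp add: A_def space_N)
    have [measurable]: "(\<lambda>\<omega>. \<Sum>i\<in>{n..<n+k}. Y i \<omega>) \<in> borel_measurable N" for k
      by (intro borel_measurable_sum) auto
    have "A \<in> sets N" unfolding A by measurable
    then show "A \<in> sigma_sets (space M) ?U" by (simp only: sets_N)
  qed
qed

text \<open>
  Let \<open>F n\<close> be the maximum of the first partial sums and \<open>G n\<close> the same for the shifted sequence, which has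
  the same law. As \<open>F (Suc n) \<ge> F n\<close>, the expectation of \<open>F (Suc n) - G n\<close> is nonnegative. If the partial
  sums were unbounded almost surely, then this difference, which is dominated by \<open>\<bar>Y 0\<bar>\<close>, would converge to \<open>Y 0\<close>,
  against the negative mean. The 0-1 law leaves only almost sure boundedness.
\<close>
lemma partial_sums_bounded_of_negative_drift:
  fixes Y :: "nat \<Rightarrow> 'a \<Rightarrow> real"
  assumes indep: "indep_vars (\<lambda>_. borel) Y UNIV"
    and ident: "\<And>i j. distr M borel (Y i) = distr M borel (Y j)"
    and int: "\<And>i. integrable M (Y i)" and drift: "expectation (Y 0) < 0"
  shows "AE \<omega> in M. \<exists>B. \<forall>k. (\<Sum>i<k. Y i \<omega>) \<le> B"
proof -
  have meas [measurable]: "Y i \<in> borel_measurable M" for i using int by auto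
  define A where "A = {\<omega>\<in>space M. \<forall>B::nat. \<exists>k. real B < (\<Sum>i<k. Y i \<omega>)}"
  have [measurable]: "A \<in> sets M" unfolding A_def by measurable
  have "prob A \<noteq> 1"
  proof
    assume "prob A = 1"
    then have AE_A: "AE \<omega> in M. \<omega> \<in> A" by (simp add: prob_eq_1)
    define F where "F n \<omega> = max_partial_sum n (\<lambda>i. Y i \<omega>)" for n \<omega>
    define G where "G n \<omega> = max_partial_sum n (\<lambda>i. Y (Suc i) \<omega>)" for n \<omega>
    have [measurable]: "F n \<in> borel_measurable M" "G n \<in> borel_measurable M" for n
      unfolding F_def G_def by measurable
    have intF: "integrable M (F n)" for n
    proof (rule Bochner_Integration.integrable_bound[where f = "\<lambda>\<omega>. \<Sum>i<n. \<bar>Y i \<omega>\<bar>"])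
      show "AE \<omega> in M. norm (F n \<omega>) \<le> norm (\<Sum>i<n. \<bar>Y i \<omega>\<bar>)"
        using max_partial_sum_le max_partial_sum_nonneg by (auto simp: F_def sum_nonneg)
    qed (use int in auto)
    have intG: "integrable M (G n)" for n
    proof (rule Bochner_Integration.integrable_bound[where f = "\<lambda>\<omega>. \<Sum>i<n. \<bar>Y (Suc i) \<omega>\<bar>"])
      show "AE \<omega> in M. norm (G n \<omega>) \<le> norm (\<Sum>i<n. \<bar>Y (Suc i) \<omega>\<bar>)"
        using max_partial_sum_le[of n "\<lambda>i. Y (Suc i) _"] max_partial_sum_nonneg by (auto simp: G_def sum_nonneg)
    qed (use int in auto)
    have indep': "indep_vars (\<lambda>_. borel) (\<lambda>i. Y (Suc i)) UNIV"
      by (rule indep_vars_reindex[OF indep]) auto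
    have EFG: "expectation (G n) = expectation (F n)" for n
    proof -
      let ?P = "PiM UNIV (\<lambda>_::nat. borel :: real measure)"
      have [measurable]: "max_partial_sum n \<in> borel_measurable ?P"
        using borel_measurable_max_partial_sum[of "\<lambda>i y. y i" ?P n] by simp
      have [measurable]: "(\<lambda>\<omega> i. Y i \<omega>) \<in> measurable M ?P" "(\<lambda>\<omega> i. Y (Suc i) \<omega>) \<in> measurable M ?P"
        by (rule measurable_restrict[where I = UNIV, unfolded restrict_UNIV], simp)+
      have "expectation (G n) = (\<integral>y. max_partial_sum n y \<partial>distr M ?P (\<lambda>\<omega> i. Y (Suc i) \<omega>))"
        unfolding G_def by (subst integral_distr) auto
      also have "distr M ?P (\<lambda>\<omega> i. Y (Suc i) \<omega>) = distr M ?P (\<lambda>\<omega> i. Y i \<omega>)"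
        by (rule iid_sequence_distr_eq[OF indep' indep ident])
      also have "(\<integral>y. max_partial_sum n y \<partial>distr M ?P (\<lambda>\<omega> i. Y i \<omega>)) = expectation (F n)"
        unfolding F_def by (subst integral_distr) auto
      finally show ?thesis .
    qed
    have "(\<lambda>n. expectation (\<lambda>\<omega>. F (Suc n) \<omega> - G n \<omega>)) \<longlonglongrightarrow> expectation (Y 0)"
    proof (rule integral_dominated_convergence[where w = "\<lambda>\<omega>. \<bar>Y 0 \<omega>\<bar>"])
      show "AE \<omega> in M. (\<lambda>n. F (Suc n) \<omega> - G n \<omega>) \<longlonglongrightarrow> Y 0 \<omega>"
        using AE_A
      proof eventually_elim
        case (elim \<omega>)
        then show ?case unfolding F_def G_def by (intro max_partial_sum_shift_tendsto) (auto simp: A_def)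
      qed
      show "AE \<omega> in M. norm (F (Suc n) \<omega> - G n \<omega>) \<le> \<bar>Y 0 \<omega>\<bar>" for n
      proof (rule AE_I2)
        fix \<omega>
        have "0 \<le> G n \<omega>" by (simp add: G_def max_partial_sum_nonneg)
        moreover have "F (Suc n) \<omega> = max 0 (Y 0 \<omega> + G n \<omega>)" by (simp add: F_def G_def)
        ultimately show "norm (F (Suc n) \<omega> - G n \<omega>) \<le> \<bar>Y 0 \<omega>\<bar>" by (simp add: max_def abs_if)
      qed
    qed (use int in auto)
    moreover have "0 \<le> expectation (\<lambda>\<omega>. F (Suc n) \<omega> - G n \<omega>)" for n
    proof -
      have "expectation (\<lambda>\<omega>. F (Suc n) \<omega> - G n \<omega>) = expectation (\<lambda>\<omega>. F (Suc n) \<omega> - F n \<omega>)"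
        using intF intG by (simp add: EFG)
      also have "\<dots> \<ge> 0"
        unfolding F_def using max_partial_sum_mono by (intro integral_nonneg_AE) (auto simp del: max_partial_sum.simps)
      finally show ?thesis .
    qed
    ultimately have "0 \<le> expectation (Y 0)" by (intro LIMSEQ_le_const) auto
    then show False using drift by simp
  qed
  then have "prob A = 0" using prob_unbounded_partial_sums_0_1[OF indep] by (simp add: A_def)
  then have "AE \<omega> in M. \<omega> \<notin> A" by (simp add: prob_eq_0)
  with AE_space show ?thesis
  proof eventually_elim
    case (elim \<omega>)
    then obtain B :: nat where "\<forall>k. (\<Sum>i<k. Y i \<omega>) \<le> real B" by (auto simp: A_def not_less)
    then show ?case by blast
  qed
qed

end

context prob_space
begin

text \<open>
  Subtracting a constant between the mean and \<open>r\<close> from the summands makes the drift negative; the shifted sums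
  are then bounded above, and the bound disappears after division by \<open>n\<close>.
\<close>
lemma mean_eventually_less:
  fixes Y :: "nat \<Rightarrow> 'a \<Rightarrow> real"
  assumes indep: "indep_vars (\<lambda>_. borel) Y UNIV"
    and ident: "\<And>i j. distr M borel (Y i) = distr M borel (Y j)"
    and int: "\<And>i. integrable M (Y i)" and r: "expectation (Y 0) < r"
  shows "AE \<omega> in M. \<forall>\<^sub>F n in sequentially. (\<Sum>i<n. Y i \<omega>) / real n < r"
proof -
  have [measurable]: "Y i \<in> borel_measurable M" for i using int by auto
  define s where "s = (expectation (Y 0) + r) / 2"
  have s: "expectation (Y 0) < s" "s < r" using r by (auto simp: s_def)
  define X where "X i \<omega> = Y i \<omega> - s" for i \<omega>
  have "AE \<omega> in M. \<exists>B. \<forall>k. (\<Sum>i<k. X i \<omega>) \<le> B"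
  proof (rule partial_sums_bounded_of_negative_drift)
    show "indep_vars (\<lambda>_. borel) X UNIV"
      unfolding X_def using indep by (rule indep_vars_compose2) auto
    show "distr M borel (X i) = distr M borel (X j)" for i j
    proof -
      have "distr M borel (X i) = distr (distr M borel (Y i)) borel (\<lambda>y. y - s)" for i
        by (subst distr_distr) (auto simp: X_def[abs_def] comp_def)
      then show ?thesis using ident[of i j] by simp
    qed
    show "integrable M (X i)" for i unfolding X_def[abs_def] by (intro Bochner_Integration.integrable_diff int) simp
    show "expectation (X 0) < 0" using int s by (simp add: X_def[abs_def] prob_space)
  qed
  then show ?thesis
  proof eventually_elim
    case (elim \<omega>)
    then obtain B where B: "(\<Sum>i<k. X i \<omega>) \<le> B" for k by blast
    have "(\<lambda>n. B / real n + s) \<longlonglongrightarrow> 0 + s" by (intro tendsto_intros)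
    then have "\<forall>\<^sub>F n in sequentially. B / real n + s < r" by (rule order_tendstoD) (use s in simp)
    with eventually_gt_at_top[of 0] show ?case
    proof eventually_elim
      case (elim n)
      have "(\<Sum>i<n. Y i \<omega>) \<le> B + real n * s" using B[of n] by (simp add: X_def sum_subtractf)
      then have "(\<Sum>i<n. Y i \<omega>) / real n \<le> B / real n + s" using elim by (simp add: field_simps)
      then show ?case using elim by linarith
    qed
  qed
qed

theorem strong_law_of_large_numbers:
  fixes Y :: "nat \<Rightarrow> 'a \<Rightarrow> real"
  assumes indep: "indep_vars (\<lambda>_. borel) Y UNIV"
    and ident: "\<And>i j. distr M borel (Y i) = distr M borel (Y j)"
    and int: "\<And>i. integrable M (Y i)"
  shows "AE \<omega> in M. (\<lambda>n. (\<Sum>i<n. Y i \<omega>) / real n) \<longlonglongrightarrow> expectation (Y 0)"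
proof -
  let ?e = "\<lambda>k. inverse (real (Suc k))"
  have [measurable]: "Y i \<in> borel_measurable M" for i using int by auto
  have "AE \<omega> in M. \<forall>\<^sub>F n in sequentially. (\<Sum>i<n. Y i \<omega>) / real n < expectation (Y 0) + ?e k" for k
    by (rule mean_eventually_less[OF indep ident int]) simp
  moreover have "AE \<omega> in M. \<forall>\<^sub>F n in sequentially. (\<Sum>i<n. - Y i \<omega>) / real n < - expectation (Y 0) + ?e k" for k
  proof (rule mean_eventually_less)
    show "indep_vars (\<lambda>_. borel) (\<lambda>i \<omega>. - Y i \<omega>) UNIV"
      using indep by (rule indep_vars_compose2) auto
    show "distr M borel (\<lambda>\<omega>. - Y i \<omega>) = distr M borel (\<lambda>\<omega>. - Y j \<omega>)" for i j
    proof -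
      have "distr M borel (\<lambda>\<omega>. - Y i \<omega>) = distr (distr M borel (Y i)) borel uminus" for i
        by (subst distr_distr) (auto simp: comp_def)
      then show ?thesis using ident[of i j] by simp
    qed
  qed (use int in auto)
  ultimately have "AE \<omega> in M. \<forall>k.
      (\<forall>\<^sub>F n in sequentially. (\<Sum>i<n. Y i \<omega>) / real n < expectation (Y 0) + ?e k) \<and>
      (\<forall>\<^sub>F n in sequentially. (\<Sum>i<n. - Y i \<omega>) / real n < - expectation (Y 0) + ?e k)"
    by (simp add: AE_all_countable)
  then show ?thesis
  proof eventually_elim
    case (elim \<omega>)
    show ?case
    proof (rule tendstoI)
      fix r :: real assume "0 < r"
      then obtain k where k: "?e k < r" using reals_Archimedean by blast
      from elim[THEN spec, of k] have
        "\<forall>\<^sub>F n in sequentially. (\<Sum>i<n. Y i \<omega>) / real n < expectation (Y 0) + ?e k"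
        "\<forall>\<^sub>F n in sequentially. (\<Sum>i<n. - Y i \<omega>) / real n < - expectation (Y 0) + ?e k" by auto
      then show "\<forall>\<^sub>F n in sequentially. dist ((\<Sum>i<n. Y i \<omega>) / real n) (expectation (Y 0)) < r"
      proof eventually_elim
        case (elim n)
        have "(\<Sum>i<n. - Y i \<omega>) / real n = - ((\<Sum>i<n. Y i \<omega>) / real n)" by (simp add: sum_negf)
        then show ?case using elim k unfolding dist_real_def by linarith
      qed
    qed
  qed
qed

section \<open>Lengths of blocks of spacings\<close>

text \<open>
  Chernoff's bound: Markov's inequality for \<open>exp (- S)\<close>, where \<open>S\<close> is the length of the block.
\<close>
lemma prob_short_block_le:
  fixes Z :: "int \<Rightarrow> 'a \<Rightarrow> real"
  assumes indep: "indep_vars (\<lambda>_. borel) Z UNIV"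
    and ident: "\<And>i j. distr M borel (Z i) = distr M borel (Z j)"
    and pos: "\<And>i. AE \<omega> in M. 0 < Z i \<omega>"
  shows "prob {\<omega>\<in>space M. (\<Sum>j<m. Z (i + int j) \<omega>) \<le> 1} \<le> exp 1 * expectation (\<lambda>\<omega>. exp (- Z 0 \<omega>)) ^ m"
proof -
  have [measurable]: "Z i \<in> borel_measurable M" for i using indep by (auto simp: indep_vars_def)
  have int: "integrable M (\<lambda>\<omega>. exp (- Z i \<omega>))" for i
    by (rule integrable_const_bound[of _ 1]) (use pos[of i] in \<open>auto elim: eventually_mono\<close>)
  have same: "expectation (\<lambda>\<omega>. exp (- Z i \<omega>)) = expectation (\<lambda>\<omega>. exp (- Z 0 \<omega>))" for i
  proof -
    have "expectation (\<lambda>\<omega>. exp (- Z i \<omega>)) = (\<integral>z. exp (- z) \<partial>distr M borel (Z i))" for i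
      by (subst integral_distr) auto
    then show ?thesis using ident[of i 0] by simp
  qed
  have indep': "indep_vars (\<lambda>_. borel) (\<lambda>j \<omega>. exp (- Z (i + int j) \<omega>)) {..<m}"
  proof -
    have "indep_vars (\<lambda>_. borel) (\<lambda>j. Z (i + int j)) {..<m}"
      by (rule indep_vars_reindex[OF indep]) (auto simp: inj_on_def)
    then show ?thesis by (rule indep_vars_compose2) auto
  qed
  let ?u = "\<lambda>\<omega>. \<Prod>j<m. exp (- Z (i + int j) \<omega>)"
  have u: "?u \<omega> = exp (- (\<Sum>j<m. Z (i + int j) \<omega>))" for \<omega>
    by (simp add: exp_sum[symmetric] sum_negf)
  have int_u: "integrable M ?u"
    by (rule indep_vars_integrable[OF _ indep']) (use int in auto)
  have "expectation ?u = (\<Prod>j<m. expectation (\<lambda>\<omega>. exp (- Z (i + int j) \<omega>)))"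
    by (rule indep_vars_lebesgue_integral[OF _ indep']) (use int in auto)
  also have "\<dots> = expectation (\<lambda>\<omega>. exp (- Z 0 \<omega>)) ^ m"
    by (subst prod.cong[OF refl same]) simp
  finally have E: "expectation ?u = expectation (\<lambda>\<omega>. exp (- Z 0 \<omega>)) ^ m" .
  let ?v = "\<lambda>\<omega>. exp (- (\<Sum>j<m. Z (i + int j) \<omega>))"
  have "prob {\<omega>\<in>space M. exp (- 1) \<le> ?v \<omega>} \<le> expectation ?v / exp (- 1)"
  proof (rule integral_Markov_inequality_measure)
    show "integrable M ?v" using int_u by (simp only: u)
    show "{} \<in> events" by (rule sets.empty_sets)
    show "AE \<omega> in M. 0 \<le> ?v \<omega>" by (intro AE_I2 exp_ge_zero)
  qed (rule exp_gt_zero)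
  moreover have "expectation ?v = expectation (\<lambda>\<omega>. exp (- Z 0 \<omega>)) ^ m" using E by (simp only: u)
  moreover have "exp (- 1) \<le> ?v \<omega> \<longleftrightarrow> (\<Sum>j<m. Z (i + int j) \<omega>) \<le> 1" for \<omega>
    by (simp only: exp_le_cancel_iff neg_le_iff_le)
  moreover have "c / exp (- 1) = exp 1 * c" for c :: real
    by (simp add: exp_minus divide_inverse)
  ultimately show ?thesis by (simp only:)
qed

text \<open>
  As \<open>Z 0 > 0\<close>, the Laplace transform \<open>\<rho> = E (exp (- Z 0))\<close> is less than \<open>1\<close>. Blocks of \<open>A * ln n\<close> spacings
  are short with probability \<open>O(n powr (A * ln \<rho>))\<close>, which for \<open>A = 3 / (- ln \<rho>)\<close> is \<open>O(1 / n ^ 3)\<close>. This is still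
  summable over \<open>n\<close> after the union bound over the \<open>O(n)\<close> starting points.
\<close>
lemma logarithmic_blocks_are_long:
  fixes Z :: "int \<Rightarrow> 'a \<Rightarrow> real"
  assumes indep: "indep_vars (\<lambda>_. borel) Z UNIV"
    and ident: "\<And>i j. distr M borel (Z i) = distr M borel (Z j)"
    and pos: "\<And>i. AE \<omega> in M. 0 < Z i \<omega>"
  shows "\<exists>A>0. \<forall>K. AE \<omega> in M. \<forall>\<^sub>F n in sequentially. \<forall>i. \<bar>real_of_int i\<bar> \<le> K * real n \<longrightarrow>
    1 \<le> (\<Sum>j<nat \<lceil>A * ln (real n)\<rceil>. Z (i + int j) \<omega>)"
proof -
  have [measurable]: "Z i \<in> borel_measurable M" for i using indep by (auto simp: indep_vars_def)
  define \<rho> where "\<rho> = expectation (\<lambda>\<omega>. exp (- Z 0 \<omega>))"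
  have int: "integrable M (\<lambda>\<omega>. exp (- Z 0 \<omega>))"
    by (rule integrable_const_bound[of _ 1]) (use pos[of 0] in \<open>auto elim: eventually_mono\<close>)
  have "\<rho> < 1" unfolding \<rho>_def
    by (rule expectation_less[OF int]) (use pos[of 0] in \<open>auto elim: eventually_mono\<close>)
  moreover have "0 < \<rho>" unfolding \<rho>_def
    by (rule expectation_greater[OF int]) auto
  ultimately have \<rho>: "0 < \<rho>" "\<rho> < 1" "ln \<rho> < 0" by auto
  define A where "A = 3 / (- ln \<rho>)"
  have A: "0 < A" using \<rho> by (simp add: A_def divide_pos_neg)
  define m where "m n = nat \<lceil>A * ln (real n)\<rceil>" for n
  have decay: "\<rho> ^ m n \<le> 1 / real n ^ 3" if "0 < n" for n
  proof -
    have "A * ln (real n) \<le> real (m n)" by (simp add: m_def of_nat_ceiling)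
    then have "\<rho> powr real (m n) \<le> \<rho> powr (A * ln (real n))" using \<rho> by (simp add: powr_mono')
    also have "\<dots> = exp (- 3 * ln (real n))" using \<rho> by (simp add: powr_def A_def)
    also have "\<dots> = 1 / real n ^ 3" using that by (simp add: exp_minus exp_of_nat_mult[of 3 "ln (real n)", simplified] field_simps)
    finally show ?thesis using \<rho> by (simp add: powr_realpow)
  qed
  have "AE \<omega> in M. \<forall>\<^sub>F n in sequentially. \<forall>i. \<bar>real_of_int i\<bar> \<le> K * real n \<longrightarrow>
    1 \<le> (\<Sum>j<m n. Z (i + int j) \<omega>)" for K
  proof -
    define I where "I n = {i::int. \<bar>real_of_int i\<bar> \<le> \<bar>K\<bar> * real n}" for n
    have I_eq: "I n = {- \<lfloor>\<bar>K\<bar> * real n\<rfloor>..\<lfloor>\<bar>K\<bar> * real n\<rfloor>}" for n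
      by (auto simp: I_def abs_le_iff le_floor_iff) linarith+
    then have fin: "finite (I n)" for n by simp
    have card: "real (card (I n)) \<le> 2 * \<bar>K\<bar> * real n + 1" for n
    proof -
      have "0 \<le> \<lfloor>\<bar>K\<bar> * real n\<rfloor>" by simp
      then have "real (card (I n)) = 2 * real_of_int \<lfloor>\<bar>K\<bar> * real n\<rfloor> + 1" unfolding I_eq by simp
      then show ?thesis using of_int_floor_le[of "\<bar>K\<bar> * real n"] by linarith
    qed
    define bad where "bad n i = {\<omega>\<in>space M. (\<Sum>j<m n. Z (i + int j) \<omega>) \<le> 1}" for n i
    have [measurable]: "bad n i \<in> sets M" for n i unfolding bad_def by measurable
    have "AE \<omega> in M. \<forall>\<^sub>F n in sequentially. \<omega> \<in> space M - (\<Union>i\<in>I n. bad n i)"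
    proof (rule borel_cantelli_AE1)
      have le: "prob (\<Union>i\<in>I n. bad n i) \<le> (2 * \<bar>K\<bar> * real n + 1) * (exp 1 / real n ^ 3)" if "0 < n" for n
      proof -
        have "prob (\<Union>i\<in>I n. bad n i) \<le> (\<Sum>i\<in>I n. prob (bad n i))"
          by (rule finite_measure_subadditive_finite) (auto simp: fin)
        also have "\<dots> \<le> (\<Sum>i\<in>I n. exp 1 * (1 / real n ^ 3))"
        proof (rule sum_mono)
          fix i
          have "prob (bad n i) \<le> exp 1 * \<rho> ^ m n"
            unfolding bad_def \<rho>_def by (rule prob_short_block_le[OF indep ident pos])
          also have "\<dots> \<le> exp 1 * (1 / real n ^ 3)" using decay[OF that] by (intro mult_left_mono) auto
          finally show "prob (bad n i) \<le> exp 1 * (1 / real n ^ 3)" .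
        qed
        also have "\<dots> = real (card (I n)) * (exp 1 / real n ^ 3)" by simp
        also have "\<dots> \<le> (2 * \<bar>K\<bar> * real n + 1) * (exp 1 / real n ^ 3)"
          using card by (intro mult_right_mono) auto
        finally show ?thesis .
      qed
      have "summable (\<lambda>n. (2 * \<bar>K\<bar> * real n + 1) * (exp 1 / real n ^ 3))"
      proof (rule summable_comparison_test_bigo)
        show "summable (\<lambda>n. norm (1 / real n ^ 2))"
          using inverse_power_summable[of 2, where 'a = real] by (simp add: field_simps)
        have "0 \<le> \<bar>K\<bar>" by simp
        then show "(\<lambda>n. (2 * \<bar>K\<bar> * real n + 1) * (exp 1 / real n ^ 3)) \<in> O(\<lambda>n. 1 / real n ^ 2)"
          by real_asymp
      qed
      moreover have "\<forall>\<^sub>F n in sequentially. norm (prob (\<Union>i\<in>I n. bad n i)) \<le> (2 * \<bar>K\<bar> * real n + 1) * (exp 1 / real n ^ 3)"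
        using eventually_gt_at_top[of 0]
      proof eventually_elim
        case (elim n)
        from le[OF elim] show ?case by (simp only: real_norm_def abs_of_nonneg[OF measure_nonneg])
      qed
      ultimately show "summable (\<lambda>n. prob (\<Union>i\<in>I n. bad n i))"
        by (rule summable_comparison_test_ev[rotated])
      show "(\<Union>i\<in>I n. bad n i) \<in> events" for n
        by (rule sets.finite_UN[OF fin]) measurable
      show "emeasure M (\<Union>i\<in>I n. bad n i) < \<infinity>" for n
        by (simp add: emeasure_eq_measure)
    qed
    then show ?thesis
    proof eventually_elim
      case (elim \<omega>)
      then show ?case
      proof eventually_elim
        case (elim n)
        show ?case
        proof (intro allI impI)
          fix i assume i: "\<bar>real_of_int i\<bar> \<le> K * real n"
          have "K * real n \<le> \<bar>K\<bar> * real n" by (intro mult_right_mono) auto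
          then have "i \<in> I n" using i by (simp add: I_def)
          then show "1 \<le> (\<Sum>j<m n. Z (i + int j) \<omega>)" using elim by (auto simp: bad_def)
        qed
      qed
    qed
  qed
  then show ?thesis
    unfolding m_def by (intro exI[of _ A] conjI allI A)
qed

end

section \<open>The renewal process\<close>

lemma renewal_seq_shift: "renewal_seq z (i + int m) = renewal_seq z i + (\<Sum>j<m. z (i + int j))"
proof (induction m)
  case (Suc m)
  then show ?case using renewal_seq_step[of z "i + int (Suc m)"] by (simp add: add.assoc[symmetric])
qed simp

lemma renewal_seq_int: "renewal_seq z (int n) = (\<Sum>j<n. z (int j))"
  using renewal_seq_shift[of z 0 n] by (simp add: renewal_seq_0)

lemma renewal_seq_neg_int: "- renewal_seq z (- int n) = (\<Sum>j<n. z (- 1 - int j))"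
proof (induction n)
  case (Suc n)
  have "- int (Suc n) = - int n - 1" "- 1 - int n = - int n - 1" by simp_all
  then show ?case using renewal_seq_step[of z "- int n"] Suc by (simp only: sum.lessThan_Suc)
qed (simp add: renewal_seq_0)

lemma strict_mono_renewal_seq:
  assumes "\<And>i. 0 < z i"
  shows "strict_mono (renewal_seq z)"
proof (rule strict_monoI)
  fix i j :: int assume "i < j"
  then obtain m where m: "j = i + int (Suc m)" using zless_iff_Suc_zadd[of i j] by auto
  have "0 < (\<Sum>l<Suc m. z (i + int l))" using assms by (intro sum_pos) auto
  then show "renewal_seq z i < renewal_seq z j" by (simp only: m renewal_seq_shift)
qed

lemma (in prob_space) renewal_seq_linear_growth:
  fixes Z :: "int \<Rightarrow> 'a \<Rightarrow> real"
  assumes indep: "indep_vars (\<lambda>_. borel) Z UNIV"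
    and ident: "\<And>i j. distr M borel (Z i) = distr M borel (Z j)"
    and int: "\<And>i. integrable M (Z i)"
  shows "AE \<omega> in M. (\<lambda>n. renewal_seq (\<lambda>i. Z i \<omega>) (int n) / real n) \<longlonglongrightarrow> expectation (Z 0) \<and>
    (\<lambda>n. - renewal_seq (\<lambda>i. Z i \<omega>) (- int n) / real n) \<longlonglongrightarrow> expectation (Z 0)"
proof -
  have [measurable]: "Z i \<in> borel_measurable M" for i using int by auto
  have "expectation (Z i) = (\<integral>z. z \<partial>distr M borel (Z i))" for i by (subst integral_distr) auto
  then have mean: "expectation (Z (- 1)) = expectation (Z 0)" using ident[of "- 1" 0] by simp
  have "AE \<omega> in M. (\<lambda>n. (\<Sum>j<n. Z (int j) \<omega>) / real n) \<longlonglongrightarrow> expectation (Z (int 0))"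
    by (rule strong_law_of_large_numbers[OF indep_vars_reindex[OF indep] ident int]) (auto simp: inj_on_def)
  moreover have "AE \<omega> in M. (\<lambda>n. (\<Sum>j<n. Z (- 1 - int j) \<omega>) / real n) \<longlonglongrightarrow> expectation (Z (- 1 - int 0))"
    by (rule strong_law_of_large_numbers[OF indep_vars_reindex[OF indep] ident int]) (auto simp: inj_on_def)
  ultimately show ?thesis
    unfolding renewal_seq_int renewal_seq_neg_int by (auto simp: mean elim: eventually_elim2)
qed

text \<open>
  Both assertions of the theorem are instances: \<open>f L = (ln L)\<^sup>2\<close> with logarithmic blocks and \<open>f L = 1\<close> with
  single spacings.
\<close>
lemma (in prob_space) renewal_cheeger_bounds:
  fixes Z :: "int \<Rightarrow> 'a \<Rightarrow> real" and \<alpha> \<gamma> \<epsilon> :: real and m :: "nat \<Rightarrow> nat"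
  assumes \<alpha>: "0 < \<alpha>" and \<gamma>: "0 < \<gamma>" "\<gamma> < 1" and \<epsilon>: "0 < \<epsilon>"
    and indep: "indep_vars (\<lambda>_. borel) Z UNIV"
    and ident: "\<And>i j. distr M borel (Z i) = distr M borel (Z j)"
    and pos: "\<And>i. AE \<omega> in M. 0 < Z i \<omega>"
    and int: "\<And>i. integrable M (Z i)"
    and m: "\<forall>\<^sub>F n in sequentially. 0 < m n"
    and blocks: "AE \<omega> in M. \<forall>\<^sub>F n in sequentially. \<forall>i. \<bar>real_of_int i\<bar> \<le> 1 / expectation (Z 0) * real n \<longrightarrow>
      \<epsilon> \<le> (\<Sum>j<m n. Z (i + int j) \<omega>)"
    and f: "0 < K" "\<forall>\<^sub>F n in sequentially. (real (m n))\<^sup>2 \<le> K * f (real n)"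
  shows "\<exists>C>0. AE \<omega> in M. \<forall>\<^sub>F n in sequentially. let L = real n; x = renewal_seq (\<lambda>i. Z i \<omega>) in
      1 / (C * L) * exp (- (max_gap x L powr \<alpha>)) \<le> cheeger \<alpha> (range x) L \<and>
      cheeger \<alpha> (range x) L \<le> C * f L / L * exp (- (d_exp \<alpha> * max_gap x (\<gamma> * L) powr \<alpha>))"
proof -
  define \<mu> where "\<mu> = expectation (Z 0)"
  have \<mu>: "0 < \<mu>" unfolding \<mu>_def by (rule expectation_greater[OF int pos])
  obtain C where C: "0 < C" and bounds: "\<And>x m. strict_mono x \<Longrightarrow> x 0 = 0 \<Longrightarrow>
      (\<lambda>n. x (int n) / real n) \<longlonglongrightarrow> \<mu> \<Longrightarrow> (\<lambda>n. - x (- int n) / real n) \<longlonglongrightarrow> \<mu> \<Longrightarrow>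
      (\<forall>\<^sub>F n in sequentially. 0 < m n \<and>
        (\<forall>i. \<bar>real_of_int i\<bar> \<le> real n / \<mu> \<longrightarrow> x i + \<epsilon> \<le> x (i + int (m n)))) \<Longrightarrow>
      (\<forall>\<^sub>F n in sequentially.
        1 / (C * real n) * exp (- (max_gap x (real n) powr \<alpha>)) \<le> cheeger \<alpha> (range x) (real n) \<and>
        cheeger \<alpha> (range x) (real n)
          \<le> C * (real (m n))\<^sup>2 / real n * exp (- (d_exp \<alpha> * max_gap x (\<gamma> * real n) powr \<alpha>)))"
    using cheeger_bounds[OF \<mu> \<gamma> \<epsilon> \<alpha>] by blast
  define D where "D = max C (C * K)"
  have D: "0 < D" "C \<le> D" "C * K \<le> D" using C by (auto simp: D_def)
  have "AE \<omega> in M. \<forall>i. 0 < Z i \<omega>" using pos by (simp add: AE_all_countable)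
  then have "AE \<omega> in M. \<forall>\<^sub>F n in sequentially. let L = real n; x = renewal_seq (\<lambda>i. Z i \<omega>) in
      1 / (D * L) * exp (- (max_gap x L powr \<alpha>)) \<le> cheeger \<alpha> (range x) L \<and>
      cheeger \<alpha> (range x) L \<le> D * f L / L * exp (- (d_exp \<alpha> * max_gap x (\<gamma> * L) powr \<alpha>))"
    using renewal_seq_linear_growth[OF indep ident int] blocks
  proof eventually_elim
    case (elim \<omega>)
    define x where "x = renewal_seq (\<lambda>i. Z i \<omega>)"
    have "\<forall>\<^sub>F n in sequentially. 0 < m n \<and>
        (\<forall>i. \<bar>real_of_int i\<bar> \<le> real n / \<mu> \<longrightarrow> x i + \<epsilon> \<le> x (i + int (m n)))"
      using elim(3) m by eventually_elim (auto simp: x_def renewal_seq_shift \<mu>_def)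
    then have "\<forall>\<^sub>F n in sequentially.
        1 / (C * real n) * exp (- (max_gap x (real n) powr \<alpha>)) \<le> cheeger \<alpha> (range x) (real n) \<and>
        cheeger \<alpha> (range x) (real n)
          \<le> C * (real (m n))\<^sup>2 / real n * exp (- (d_exp \<alpha> * max_gap x (\<gamma> * real n) powr \<alpha>))"
      using elim(1,2) by (intro bounds) (auto simp: x_def \<mu>_def renewal_seq_0 strict_mono_renewal_seq)
    with eventually_gt_at_top[of 0] f(2) show ?case
      unfolding Let_def x_def[symmetric]
    proof eventually_elim
      case (elim n)
      have "1 / (D * real n) * exp (- (max_gap x (real n) powr \<alpha>))
          \<le> 1 / (C * real n) * exp (- (max_gap x (real n) powr \<alpha>))"
        using C D elim by (intro mult_right_mono frac_le) auto
      moreover have "C * (real (m n))\<^sup>2 / real n * exp (- (d_exp \<alpha> * max_gap x (\<gamma> * real n) powr \<alpha>))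
          \<le> D * f (real n) / real n * exp (- (d_exp \<alpha> * max_gap x (\<gamma> * real n) powr \<alpha>))"
      proof (intro mult_right_mono divide_right_mono)
        have "0 \<le> K * f (real n)" using elim(2) zero_le_power2[of "real (m n)"] by linarith
        then have "0 \<le> f (real n)" using f(1) by (simp add: zero_le_mult_iff)
        have "C * (real (m n))\<^sup>2 \<le> C * (K * f (real n))" using elim C by (intro mult_left_mono) auto
        also have "\<dots> \<le> D * f (real n)" using D \<open>0 \<le> f (real n)\<close> by (simp add: mult.assoc[symmetric] mult_right_mono)
        finally show "C * (real (m n))\<^sup>2 \<le> D * f (real n)" .
      qed auto
      ultimately show ?case using elim by linarith
    qed
  qed
  then show ?thesis using D(1) by blast
qed

theorem proposition1p3:
  fixes M :: "'a measure" and Z :: "int \<Rightarrow> 'a \<Rightarrow> real" and \<alpha> :: real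
  assumes "prob_space M"
    and "0 < \<alpha>"
    and "prob_space.indep_vars M (\<lambda>_. borel) Z UNIV"
    and "\<And>i j. distr M borel (Z i) = distr M borel (Z j)"
    and "\<And>i. AE \<omega> in M. 0 < Z i \<omega>"
    and "\<And>i. integrable M (Z i)"
  shows "(\<forall>\<gamma>. 0 < \<gamma> \<and> \<gamma> < 1 \<longrightarrow>
           (\<exists>C>0. AE \<omega> in M. \<forall>\<^sub>F n in sequentially.
              let L = real n; x = renewal_seq (\<lambda>i. Z i \<omega>) in
                1 / (C * L) * exp (- (max_gap x L powr \<alpha>)) \<le> cheeger \<alpha> (range x) L \<and>
                cheeger \<alpha> (range x) L
                  \<le> C * (ln L)\<^sup>2 / L * exp (- (d_exp \<alpha> * max_gap x (\<gamma> * L) powr \<alpha>)))) \<and>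
         ((\<exists>\<epsilon>>0. \<forall>i. measure M {\<omega> \<in> space M. Z i \<omega> > \<epsilon>} = 1) \<longrightarrow>
           (\<forall>\<gamma>. 0 < \<gamma> \<and> \<gamma> < 1 \<longrightarrow>
             (\<exists>C>0. AE \<omega> in M. \<forall>\<^sub>F n in sequentially.
                let L = real n; x = renewal_seq (\<lambda>i. Z i \<omega>) in
                  1 / (C * L) * exp (- (max_gap x L powr \<alpha>)) \<le> cheeger \<alpha> (range x) L \<and>
                  cheeger \<alpha> (range x) L
                    \<le> C / L * exp (- (d_exp \<alpha> * max_gap x (\<gamma> * L) powr \<alpha>)))))"
proof -
  interpret prob_space M by fact
  note iid = assms(3,4,5)
  have [measurable]: "Z i \<in> borel_measurable M" for i using assms(6) by auto
  show ?thesis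
  proof (intro conjI impI allI)
    fix \<gamma> :: real assume \<gamma>: "0 < \<gamma> \<and> \<gamma> < 1"
    obtain A where A: "0 < A" and blocks: "\<And>K. AE \<omega> in M. \<forall>\<^sub>F n in sequentially.
        \<forall>i. \<bar>real_of_int i\<bar> \<le> K * real n \<longrightarrow> 1 \<le> (\<Sum>j<nat \<lceil>A * ln (real n)\<rceil>. Z (i + int j) \<omega>)"
      using logarithmic_blocks_are_long[OF iid] by blast
    show "\<exists>C>0. AE \<omega> in M. \<forall>\<^sub>F n in sequentially.
              let L = real n; x = renewal_seq (\<lambda>i. Z i \<omega>) in
                1 / (C * L) * exp (- (max_gap x L powr \<alpha>)) \<le> cheeger \<alpha> (range x) L \<and>
                cheeger \<alpha> (range x) L
                  \<le> C * (ln L)\<^sup>2 / L * exp (- (d_exp \<alpha> * max_gap x (\<gamma> * L) powr \<alpha>))"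
    \<comment> \<open>Rounding up the block length costs at most one, which \<open>ln n \<ge> 1\<close> absorbs; hence \<open>A + 1\<close>.\<close>
    proof (rule renewal_cheeger_bounds[where f = "\<lambda>L. (ln L)\<^sup>2" and m = "\<lambda>n. nat \<lceil>A * ln (real n)\<rceil>" and K = "(A + 1)\<^sup>2" and \<epsilon> = 1])
      show "\<forall>\<^sub>F n in sequentially. 0 < nat \<lceil>A * ln (real n)\<rceil>" using A by real_asymp
      have "\<forall>\<^sub>F n in sequentially. 1 \<le> ln (real n)" by real_asymp
      then show "\<forall>\<^sub>F n in sequentially. (real (nat \<lceil>A * ln (real n)\<rceil>))\<^sup>2 \<le> (A + 1)\<^sup>2 * (ln (real n))\<^sup>2"
      proof eventually_elim
        case (elim n)
        have "0 \<le> A * ln (real n)" using A elim by simp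
        then have "real (nat \<lceil>A * ln (real n)\<rceil>) \<le> A * ln (real n) + 1" by linarith
        also have "\<dots> \<le> (A + 1) * ln (real n)" using elim by (simp add: algebra_simps)
        finally show ?case by (simp only: power_mult_distrib[symmetric]) (intro power_mono, auto)
      qed
    qed (use assms \<gamma> A blocks[of "1 / expectation (Z 0)"] in auto)
  next
    assume "\<exists>\<epsilon>>0. \<forall>i. measure M {\<omega> \<in> space M. Z i \<omega> > \<epsilon>} = 1"
    then obtain \<epsilon> where \<epsilon>: "0 < \<epsilon>" "\<And>i. prob {\<omega> \<in> space M. Z i \<omega> > \<epsilon>} = 1" by blast
    have "AE \<omega> in M. \<forall>i. \<epsilon> < Z i \<omega>"
      unfolding AE_all_countable using \<epsilon>(2) by (simp add: prob_Collect_eq_1)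
    then have blocks: "AE \<omega> in M. \<forall>\<^sub>F n in sequentially. \<forall>i. \<bar>real_of_int i\<bar> \<le> 1 / expectation (Z 0) * real n \<longrightarrow>
        \<epsilon> \<le> (\<Sum>j<1. Z (i + int j) \<omega>)"
      by eventually_elim (auto intro!: always_eventually less_imp_le)
    fix \<gamma> :: real assume \<gamma>: "0 < \<gamma> \<and> \<gamma> < 1"
    have "\<exists>C>0. AE \<omega> in M. \<forall>\<^sub>F n in sequentially.
              let L = real n; x = renewal_seq (\<lambda>i. Z i \<omega>) in
                1 / (C * L) * exp (- (max_gap x L powr \<alpha>)) \<le> cheeger \<alpha> (range x) L \<and>
                cheeger \<alpha> (range x) L
                  \<le> C * 1 / L * exp (- (d_exp \<alpha> * max_gap x (\<gamma> * L) powr \<alpha>))"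
      by (rule renewal_cheeger_bounds[where m = "\<lambda>_. 1" and f = "\<lambda>_. 1" and K = 1 and \<epsilon> = \<epsilon>])
        (use assms \<gamma> \<epsilon>(1) blocks in auto)
    then show "\<exists>C>0. AE \<omega> in M. \<forall>\<^sub>F n in sequentially.
              let L = real n; x = renewal_seq (\<lambda>i. Z i \<omega>) in
                1 / (C * L) * exp (- (max_gap x L powr \<alpha>)) \<le> cheeger \<alpha> (range x) L \<and>
                cheeger \<alpha> (range x) L
                  \<le> C / L * exp (- (d_exp \<alpha> * max_gap x (\<gamma> * L) powr \<alpha>))"
      by simp
  qed
qed

end
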